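(* Let $\mathbf V\subseteq\mathbf{M^{+}S4}$ be of finite depth. Then $\mathbf V|_T=\mathbf{Var}(\{\mathfrak A|_U:\mathfrak A\in\mathbf V\text{ and }U\text{ is a clopen }Q\text{-cluster in the dual frame of }\mathfrak A\})$.
   Context: $\mathsf{MS4}$-algebras: $(B,\lozenge,\exists)$, $\lozenge$ an $\mathsf{S4}$ operator, $\exists$ an $\mathsf{S5}$ operator, $\exists\lozenge a\le\lozenge\exists a$; dual frames $(X,R,E)$ with $RE\subseteq ER$. $\mathbf{M^{+}S4}=\mathbf{MS4}+\mathsf{M^{+}Cas}$, $\mathsf{M^{+}Cas}=\square\forall(\square(\square p\to\square\forall p)\to\square\forall p)\to\square\forall p$. $Q=ER$; a $Q$-cluster is an equivalence class of $Q\cap Q^{-1}$. For a clopen $U$, $\mathfrak A|_U$ is the dual algebra of $(U,R\cap U^2,E\cap U^2)$ (the relativization of $\mathfrak A$ to $U$). For an s.i. $\mathfrak A$ of finite depth $h$, $\mathfrak A|_T=\mathfrak A|_{D_h}$ where $D_h$ is the bottom layer, equal to the clopen set of $Q$-roots; $\mathbf V|_T=\mathbf{Var}(\{\mathfrak A|_T:\mathfrak A\in\mathbf V\text{ s.i.}\})$. *)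

theory Defs
  imports "HOL-Analysis.Abstract_Topology" "HOL-Library.Extended_Nat"
begin

text \<open>Algebras carry an explicit carrier set, so that subalgebras, quotients and dual algebras
  are objects of the same kind. The record only fixes the signature.\<close>

record 'a bimodal =
  car :: "'a set"
  meet :: "'a \<Rightarrow> 'a \<Rightarrow> 'a"
  join :: "'a \<Rightarrow> 'a \<Rightarrow> 'a"
  neg :: "'a \<Rightarrow> 'a"
  bzero :: "'a"
  bone :: "'a"
  dia :: "'a \<Rightarrow> 'a"
  exi :: "'a \<Rightarrow> 'a"

definition leq :: "'a bimodal \<Rightarrow> 'a \<Rightarrow> 'a \<Rightarrow> bool" where
  "leq A a b \<longleftrightarrow> meet A a b = a"

locale bimodal_algebra =
  fixes A :: "'a bimodal"
  assumes meet_closed: "\<lbrakk>a \<in> car A; b \<in> car A\<rbrakk> \<Longrightarrow> meet A a b \<in> car A"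
    and join_closed: "\<lbrakk>a \<in> car A; b \<in> car A\<rbrakk> \<Longrightarrow> join A a b \<in> car A"
    and neg_closed: "a \<in> car A \<Longrightarrow> neg A a \<in> car A"
    and bzero_closed: "bzero A \<in> car A"
    and bone_closed: "bone A \<in> car A"
    and dia_closed: "a \<in> car A \<Longrightarrow> dia A a \<in> car A"
    and exi_closed: "a \<in> car A \<Longrightarrow> exi A a \<in> car A"

locale ms4_algebra = bimodal_algebra +
  assumes meet_comm: "\<lbrakk>a \<in> car A; b \<in> car A\<rbrakk> \<Longrightarrow> meet A a b = meet A b a"
    and join_comm: "\<lbrakk>a \<in> car A; b \<in> car A\<rbrakk> \<Longrightarrow> join A a b = join A b a"
    and meet_assoc: "\<lbrakk>a \<in> car A; b \<in> car A; c \<in> car A\<rbrakk>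
      \<Longrightarrow> meet A (meet A a b) c = meet A a (meet A b c)"
    and join_assoc: "\<lbrakk>a \<in> car A; b \<in> car A; c \<in> car A\<rbrakk>
      \<Longrightarrow> join A (join A a b) c = join A a (join A b c)"
    and meet_join_distrib: "\<lbrakk>a \<in> car A; b \<in> car A; c \<in> car A\<rbrakk>
      \<Longrightarrow> meet A a (join A b c) = join A (meet A a b) (meet A a c)"
    and join_meet_distrib: "\<lbrakk>a \<in> car A; b \<in> car A; c \<in> car A\<rbrakk>
      \<Longrightarrow> join A a (meet A b c) = meet A (join A a b) (join A a c)"
    and meet_one: "a \<in> car A \<Longrightarrow> meet A a (bone A) = a"
    and join_zero: "a \<in> car A \<Longrightarrow> join A a (bzero A) = a"
    and meet_neg: "a \<in> car A \<Longrightarrow> meet A a (neg A a) = bzero A"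
    and join_neg: "a \<in> car A \<Longrightarrow> join A a (neg A a) = bone A"
    and dia_zero: "dia A (bzero A) = bzero A"
    and dia_join: "\<lbrakk>a \<in> car A; b \<in> car A\<rbrakk> \<Longrightarrow> dia A (join A a b) = join A (dia A a) (dia A b)"
    and dia_refl: "a \<in> car A \<Longrightarrow> leq A a (dia A a)"
    and dia_trans: "a \<in> car A \<Longrightarrow> leq A (dia A (dia A a)) (dia A a)"
    and exi_zero: "exi A (bzero A) = bzero A"
    and exi_join: "\<lbrakk>a \<in> car A; b \<in> car A\<rbrakk> \<Longrightarrow> exi A (join A a b) = join A (exi A a) (exi A b)"
    and exi_refl: "a \<in> car A \<Longrightarrow> leq A a (exi A a)"
    and exi_trans: "a \<in> car A \<Longrightarrow> leq A (exi A (exi A a)) (exi A a)"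
    and exi_sym: "a \<in> car A \<Longrightarrow> leq A a (neg A (exi A (neg A (exi A a))))"
    and exi_dia: "a \<in> car A \<Longrightarrow> leq A (exi A (dia A a)) (dia A (exi A a))"


section \<open>Identities and varieties\<close>

datatype tm = Var nat | Meet tm tm | Join tm tm | Neg tm | Zero | One | Dia tm | Exi tm

primrec eval :: "'a bimodal \<Rightarrow> (nat \<Rightarrow> 'a) \<Rightarrow> tm \<Rightarrow> 'a" where
  "eval A v (Var n) = v n"
| "eval A v (Meet s t) = meet A (eval A v s) (eval A v t)"
| "eval A v (Join s t) = join A (eval A v s) (eval A v t)"
| "eval A v (Neg t) = neg A (eval A v t)"
| "eval A v Zero = bzero A"
| "eval A v One = bone A"
| "eval A v (Dia t) = dia A (eval A v t)"
| "eval A v (Exi t) = exi A (eval A v t)"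

definition satisfies :: "'a bimodal \<Rightarrow> tm \<times> tm \<Rightarrow> bool" where
  "satisfies A e \<longleftrightarrow> (\<forall>v. range v \<subseteq> car A \<longrightarrow> eval A v (fst e) = eval A v (snd e))"

definition models :: "(tm \<times> tm) set \<Rightarrow> 'a bimodal set" where
  "models \<Sigma> = {A. bimodal_algebra A \<and> (\<forall>e\<in>\<Sigma>. satisfies A e)}"

definition identities :: "'a bimodal set \<Rightarrow> (tm \<times> tm) set" where
  "identities K = {e. \<forall>A\<in>K. satisfies A e}"

text \<open>A variety is an equational class. A set of type \<open>'a bimodal set\<close> contains the members of the
  class whose carriers are subsets of \<open>'a\<close>.\<close>

definition variety :: "'a bimodal set \<Rightarrow> bool" where
  "variety V \<longleftrightarrow> (\<exists>\<Sigma>. V = models \<Sigma>)"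

text \<open>The variety generated by \<open>K\<close>. Its members may live on a type \<open>'b\<close> unrelated to that of the
  members of \<open>K\<close>; on the type of \<open>K\<close> it is the least variety containing \<open>K\<close>, as shown below.\<close>

definition gen_variety :: "'a bimodal set \<Rightarrow> 'b bimodal set" where
  "gen_variety K = models (identities K)"

lemma variety_gen_variety: "variety (gen_variety K)"
  by (auto simp: variety_def gen_variety_def)

lemma gen_variety_extensive: "(\<And>A. A \<in> K \<Longrightarrow> bimodal_algebra A) \<Longrightarrow> K \<subseteq> gen_variety K"
  by (auto simp: gen_variety_def models_def identities_def)

lemma gen_variety_least:
  assumes "variety W" and "K \<subseteq> W"
  shows "gen_variety K \<subseteq> W"
proof -
  obtain \<Sigma> where W: "W = models \<Sigma>"
    using assms(1) by (auto simp: variety_def)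
  then have "\<Sigma> \<subseteq> identities K"
    using assms(2) unfolding models_def identities_def by blast
  then show ?thesis
    unfolding W gen_variety_def models_def by blast
qed

abbreviation Box :: "tm \<Rightarrow> tm" where "Box t \<equiv> Neg (Dia (Neg t))"
abbreviation All :: "tm \<Rightarrow> tm" where "All t \<equiv> Neg (Exi (Neg t))"
abbreviation Imp :: "tm \<Rightarrow> tm \<Rightarrow> tm" where "Imp s t \<equiv> Join (Neg s) t"

definition MpCas :: tm where
  "MpCas = (let p = Var 0 in
     Imp (Box (All (Imp (Box (Imp (Box p) (Box (All p)))) (Box (All p))))) (Box (All p)))"

definition MpS4 :: "'a bimodal set" where
  "MpS4 = {A. ms4_algebra A \<and> satisfies A (MpCas, One)}"


section \<open>Subdirect irreducibility\<close>

definition congruence :: "'a bimodal \<Rightarrow> ('a \<times> 'a) set \<Rightarrow> bool" where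
  "congruence A \<theta> \<longleftrightarrow> equiv (car A) \<theta> \<and>
     (\<forall>(a, b)\<in>\<theta>. \<forall>(c, d)\<in>\<theta>.
        (meet A a c, meet A b d) \<in> \<theta> \<and> (join A a c, join A b d) \<in> \<theta>) \<and>
     (\<forall>(a, b)\<in>\<theta>. (neg A a, neg A b) \<in> \<theta> \<and> (dia A a, dia A b) \<in> \<theta> \<and> (exi A a, exi A b) \<in> \<theta>)"

text \<open>There is a least non-identity congruence; in particular, the algebra is nontrivial.\<close>

definition subdirectly_irreducible :: "'a bimodal \<Rightarrow> bool" where
  "subdirectly_irreducible A \<longleftrightarrow>
     (\<exists>\<mu>. congruence A \<mu> \<and> \<mu> \<noteq> Id_on (car A) \<and>
       (\<forall>\<theta>. congruence A \<theta> \<and> \<theta> \<noteq> Id_on (car A) \<longrightarrow> \<mu> \<subseteq> \<theta>))"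


section \<open>Duality\<close>

record 'p frame =
  points :: "'p topology"
  Rrel :: "('p \<times> 'p) set"
  Erel :: "('p \<times> 'p) set"

definition ultrafilter :: "'a bimodal \<Rightarrow> 'a set \<Rightarrow> bool" where
  "ultrafilter A F \<longleftrightarrow> F \<subseteq> car A \<and> bone A \<in> F \<and> bzero A \<notin> F \<and>
     (\<forall>a\<in>F. \<forall>b\<in>F. meet A a b \<in> F) \<and>
     (\<forall>a\<in>F. \<forall>b\<in>car A. leq A a b \<longrightarrow> b \<in> F) \<and>
     (\<forall>a\<in>car A. a \<in> F \<or> neg A a \<in> F)"

definition stone :: "'a bimodal \<Rightarrow> 'a \<Rightarrow> 'a set set" where
  "stone A a = {F. ultrafilter A F \<and> a \<in> F}"

definition dual_frame :: "'a bimodal \<Rightarrow> 'a set frame" where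
  "dual_frame A =
     \<lparr>points = topology_generated_by (stone A ` car A),
      Rrel = {(x, y). ultrafilter A x \<and> ultrafilter A y \<and> (\<forall>a\<in>y. dia A a \<in> x)},
      Erel = {(x, y). ultrafilter A x \<and> ultrafilter A y \<and> (\<forall>a\<in>y. exi A a \<in> x)}\<rparr>"

definition clopen_in :: "'p topology \<Rightarrow> 'p set \<Rightarrow> bool" where
  "clopen_in T U \<longleftrightarrow> openin T U \<and> closedin T U"

definition dual_algebra :: "'p frame \<Rightarrow> 'p set bimodal" where
  "dual_algebra F =
     \<lparr>car = {U. clopen_in (points F) U},
      meet = (\<inter>), join = (\<union>), neg = (\<lambda>U. topspace (points F) - U),
      bzero = {}, bone = topspace (points F),
      dia = (\<lambda>U. (Rrel F)\<inverse> `` U), exi = (\<lambda>U. (Erel F)\<inverse> `` U)\<rparr>"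

definition restrict_frame :: "'p frame \<Rightarrow> 'p set \<Rightarrow> 'p frame" where
  "restrict_frame F U =
     \<lparr>points = subtopology (points F) U, Rrel = Rrel F \<inter> U \<times> U, Erel = Erel F \<inter> U \<times> U\<rparr>"

definition relativization :: "'a bimodal \<Rightarrow> 'a set set \<Rightarrow> 'a set set bimodal" where
  "relativization A U = dual_algebra (restrict_frame (dual_frame A) U)"

text \<open>\<open>Q = ER\<close>: an \<open>R\<close>-step followed by an \<open>E\<close>-step. This is the order of composition for which
  \<open>\<exists>\<lozenge>a \<le> \<lozenge>\<exists>a\<close> corresponds to \<open>RE \<subseteq> ER\<close>; note that \<open>relcomp\<close> is written in diagrammatic order.\<close>

definition Qrel :: "'p frame \<Rightarrow> ('p \<times> 'p) set" where
  "Qrel F = Rrel F O Erel F"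

definition Q_cluster :: "'p frame \<Rightarrow> 'p set \<Rightarrow> bool" where
  "Q_cluster F C \<longleftrightarrow> C \<in> topspace (points F) // (Qrel F \<inter> (Qrel F)\<inverse>)"


section \<open>Depth\<close>

text \<open>The depth of a point is the supremum of the lengths of the strict \<open>R\<close>-chains starting at it;
  points of depth 1 are those in maximal \<open>R\<close>-clusters.\<close>

definition strict_chain :: "'p frame \<Rightarrow> 'p list \<Rightarrow> bool" where
  "strict_chain F xs \<longleftrightarrow> set xs \<subseteq> topspace (points F) \<and>
     successively (\<lambda>x y. (x, y) \<in> Rrel F \<and> (y, x) \<notin> Rrel F) xs"

definition point_depth :: "'p frame \<Rightarrow> 'p \<Rightarrow> enat" where
  "point_depth F x = (SUP xs\<in>{xs. strict_chain F xs \<and> xs \<noteq> [] \<and> hd xs = x}. enat (length xs))"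

definition layer :: "'p frame \<Rightarrow> enat \<Rightarrow> 'p set" where
  "layer F n = {x \<in> topspace (points F). point_depth F x = n}"

definition depth :: "'a bimodal \<Rightarrow> enat" where
  "depth A = (SUP x\<in>topspace (points (dual_frame A)). point_depth (dual_frame A) x)"

definition finite_depth :: "'a bimodal set \<Rightarrow> bool" where
  "finite_depth V \<longleftrightarrow> (\<exists>n. \<forall>A\<in>V. depth A \<le> enat n)"

text \<open>\<open>\<AA>|\<^sub>T\<close> is the relativization to the bottom layer \<open>D\<^sub>h\<close>, where \<open>h\<close> is the depth of \<open>\<AA>\<close>; it is
  only used for subdirectly irreducible \<open>\<AA>\<close> of finite depth.\<close>

definition bottom_algebra :: "'a bimodal \<Rightarrow> 'a set set bimodal" where
  "bottom_algebra A = relativization A (layer (dual_frame A) (depth A))"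

definition bottom_variety :: "'a bimodal set \<Rightarrow> 'b bimodal set" where
  "bottom_variety V = gen_variety (bottom_algebra ` {A \<in> V. subdirectly_irreducible A})"

end

theory Submission
  imports Defs
begin

text \<open>Everything happens on the frame of ultrafilters. Casari's axiom together with finite depth
  forces clean clusters: if \<open>x R y\<close> and \<open>x E y\<close> then \<open>y R x\<close>. Indeed, take a dirty \<open>x\<close> that is
  minimal for strict \<open>Q\<close>-steps and let \<open>H\<close> be the maximal depth in \<open>Q[x]\<close>; having depth at least
  \<open>H\<close> is an open condition, which gives a clopen \<open>U\<close> all of whose points in \<open>Q[x]\<close> have depth \<open>H\<close>,
  and the complement of \<open>R\<inverse>[W]\<close> for \<open>W = U \<inter> \<lozenge>(\<exists>U - \<lozenge>U)\<close> refutes the axiom. Hence depth is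
  invariant under \<open>E\<close>, and the bottom layer of a \<open>Q\<close>-rooted frame consists of its \<open>Q\<close>-roots.
  An algebra is subdirectly irreducible iff some nonzero \<open>c\<close> lies below \<open>\<lozenge>\<exists>b\<close> for all nonzero
  \<open>b\<close>, and then the roots form the clopen cluster \<open>\<lozenge>\<exists>c\<close>. Conversely a clopen cluster \<open>U\<close> of \<open>\<AA>\<close>
  is the set of roots of the subdirectly irreducible quotient of \<open>\<AA>\<close> dual to \<open>Q[U]\<close>.\<close>

section \<open>The ultrafilter frame\<close>

context bimodal_algebra
begin

lemmas closed = meet_closed join_closed neg_closed bzero_closed bone_closed dia_closed exi_closed

end

context ms4_algebra
begin

section \<open>Boolean arithmetic on an explicit carrier\<close>

lemma meet_zero:
  assumes a: "a \<in> car A"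
  shows "meet A a (bzero A) = bzero A"
proof -
  have "meet A a (bzero A) = join A (meet A a (bzero A)) (meet A a (neg A a))"
    using a by (simp add: meet_neg join_zero closed)
  also have "\<dots> = meet A a (join A (neg A a) (bzero A))"
    using a join_comm[of "bzero A" "neg A a"] by (simp add: meet_join_distrib[symmetric] closed)
  finally show ?thesis
    using a by (simp add: join_zero meet_neg closed)
qed

lemma meet_idem:
  assumes a: "a \<in> car A"
  shows "meet A a a = a"
proof -
  have "meet A a a = join A (meet A a a) (meet A a (neg A a))"
    using a by (simp add: meet_neg join_zero closed)
  also have "\<dots> = meet A a (join A a (neg A a))"
    using a by (simp add: meet_join_distrib closed)
  finally show ?thesis
    using a by (simp add: join_neg meet_one)
qed

lemma leq_meet_right:
  assumes "a \<in> car A" "b \<in> car A"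
  shows "leq A (meet A a b) b"
  using assms by (simp add: leq_def meet_assoc meet_idem)

lemma leq_meet_left:
  assumes "a \<in> car A" "b \<in> car A"
  shows "leq A (meet A a b) a"
  using leq_meet_right[OF assms(2,1)] meet_comm[OF assms] by simp

text \<open>Absorption comes from distributivity: once \<open>a\<close> is written as
  \<open>join A a (bzero A)\<close>, the meet becomes the join of \<open>a\<close> with a meet with
  zero.\<close>

lemma leq_join_left:
  assumes "a \<in> car A" "b \<in> car A"
  shows "leq A a (join A a b)"
proof -
  have "meet A a (join A a b) = meet A (join A a (bzero A)) (join A a b)"
    using assms by (simp add: join_zero)
  also have "\<dots> = join A a (meet A b (bzero A))"
    using assms meet_comm[of b "bzero A"] by (simp add: join_meet_distrib closed)
  finally show ?thesis
    using assms by (simp add: leq_def meet_zero join_zero)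
qed

lemma leq_join_right:
  assumes "a \<in> car A" "b \<in> car A"
  shows "leq A b (join A a b)"
  using leq_join_left[OF assms(2,1)] join_comm[OF assms] by simp

lemma meet_left_comm:
  assumes "a \<in> car A" "b \<in> car A" "c \<in> car A"
  shows "meet A a (meet A b c) = meet A b (meet A a c)"
  using assms by (simp add: meet_assoc[symmetric] meet_comm[of a b])

section \<open>Existence of ultrafilters and separation by them\<close>

text \<open>Zorn's lemma is applied to meet-closed sets that avoid zero, without asking for upward
  closure. A maximal one is an ultrafilter because every element outside it has zero meet with some
  member.\<close>

lemma ultrafilter_extension:
  assumes S: "S \<subseteq> car A" "bone A \<in> S" "bzero A \<notin> S"
    and S_meet: "\<And>a b. \<lbrakk>a \<in> S; b \<in> S\<rbrakk> \<Longrightarrow> meet A a b \<in> S"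
  obtains F where "ultrafilter A F" "S \<subseteq> F"
proof -
  define P where "P = {G. S \<subseteq> G \<and> G \<subseteq> car A \<and> bzero A \<notin> G \<and> (\<forall>a\<in>G. \<forall>b\<in>G. meet A a b \<in> G)}"
  have "S \<in> P"
    using S S_meet by (auto simp: P_def)
  have "\<exists>M\<in>P. \<forall>G\<in>P. M \<subseteq> G \<longrightarrow> G = M"
  proof (rule subset_Zorn_nonempty)
    show "P \<noteq> {}"
      using \<open>S \<in> P\<close> by blast
    show "\<Union>\<C> \<in> P" if "\<C> \<noteq> {}" and chain: "subset.chain P \<C>" for \<C>
    proof -
      have sub: "\<C> \<subseteq> P" and lin: "\<And>G H. \<lbrakk>G \<in> \<C>; H \<in> \<C>\<rbrakk> \<Longrightarrow> G \<subseteq> H \<or> H \<subseteq> G"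
        using chain by (auto simp: subset.chain_def)
      have "meet A a b \<in> \<Union>\<C>" if ab: "a \<in> G" "G \<in> \<C>" "b \<in> H" "H \<in> \<C>" for a b G H
      proof -
        obtain K where "K \<in> \<C>" "a \<in> K" "b \<in> K"
          using lin ab by blast
        then show ?thesis
          using sub unfolding P_def by blast
      qed
      then show ?thesis
        using sub \<open>\<C> \<noteq> {}\<close> unfolding P_def by blast
    qed
  qed
  then obtain M where "M \<in> P" and max: "\<And>G. \<lbrakk>G \<in> P; M \<subseteq> G\<rbrakk> \<Longrightarrow> G = M"
    by blast
  then have M: "S \<subseteq> M" "M \<subseteq> car A" "bzero A \<notin> M" "bone A \<in> M"
    and M_meet: "\<And>a b. \<lbrakk>a \<in> M; b \<in> M\<rbrakk> \<Longrightarrow> meet A a b \<in> M"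
    using S by (auto simp: P_def)
  have disjoint: "\<exists>m\<in>M. meet A m a = bzero A" if a: "a \<in> car A" "a \<notin> M" for a
  proof (rule ccontr)
    assume *: "\<not> ?thesis"
    \<comment> \<open>Adjoining all meets with \<open>a\<close> preserves meet-closure; were none of
      them zero, maximality would put \<open>meet A (bone A) a = a\<close> into
      \<open>M\<close>.\<close>
    let ?G = "M \<union> (\<lambda>m. meet A m a) ` M"
    have "meet A (meet A m a) n = meet A (meet A m n) a" "meet A n (meet A m a) = meet A (meet A m n) a"
      "meet A (meet A m a) (meet A n a) = meet A (meet A m n) a"
      if "m \<in> M" "n \<in> M" for m n
    proof -
      have "m \<in> car A" "n \<in> car A"
        using that M(2) by auto
      then show "meet A (meet A m a) n = meet A (meet A m n) a" "meet A n (meet A m a) = meet A (meet A m n) a"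
        "meet A (meet A m a) (meet A n a) = meet A (meet A m n) a"
        using a(1) meet_comm[of n a] meet_left_comm[of n m a] meet_left_comm[of a n a]
        by (simp_all add: meet_assoc meet_idem meet_closed)
    qed
    then have "\<forall>x\<in>?G. \<forall>y\<in>?G. meet A x y \<in> ?G"
      using M_meet by auto
    moreover have "?G \<subseteq> car A"
      using M(2) a(1) meet_closed by auto
    moreover have "bzero A \<notin> ?G"
      using * M(3) by (auto simp: image_iff)
    ultimately have "?G \<in> P"
      using M(1) unfolding P_def by blast
    then have "?G = M"
      using max by blast
    moreover have "meet A (bone A) a = a"
      using a(1) bone_closed meet_comm meet_one by metis
    ultimately show False
      using M(4) a(2) by (metis UnI2 imageI)
  qed
  have "ultrafilter A M"
    unfolding ultrafilter_def
  proof (intro conjI ballI impI)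
    fix a b assume ab: "a \<in> M" "b \<in> car A" "leq A a b"
    show "b \<in> M"
    proof (rule ccontr)
      assume "b \<notin> M"
      then obtain m where m: "m \<in> M" "meet A m b = bzero A"
        using disjoint ab(2) by blast
      have "meet A m a = meet A a (meet A m b)"
        using ab m(1) M(2) unfolding leq_def by (metis meet_assoc meet_comm subsetD)
      then have "meet A m a = bzero A"
        using m ab(1) M(2) meet_zero by auto
      then show False
        using M_meet[OF m(1) ab(1)] M(3) by simp
    qed
  next
    fix a assume a: "a \<in> car A"
    show "a \<in> M \<or> neg A a \<in> M"
    proof (rule ccontr)
      assume "\<not> ?thesis"
      then obtain m n where mn: "m \<in> M" "n \<in> M" "meet A m a = bzero A" "meet A n (neg A a) = bzero A"
        using disjoint a neg_closed by meson
      have c: "m \<in> car A" "n \<in> car A" "neg A a \<in> car A"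
        using mn M(2) a neg_closed by auto
      \<comment> \<open>The element \<open>?k\<close> of \<open>M\<close> annihilates both
        \<open>a\<close> and its complement, hence also their join, which is one.\<close>
      let ?k = "meet A m n"
      have k: "?k \<in> car A"
        using c meet_closed by auto
      have 1: "meet A ?k a = bzero A"
        using mn c a by (metis meet_assoc meet_comm meet_zero)
      have 2: "meet A ?k (neg A a) = bzero A"
        using mn c a by (metis meet_assoc meet_zero)
      have "?k = meet A ?k (join A a (neg A a))"
        using k a by (simp add: join_neg meet_one)
      also have "\<dots> = bzero A"
        using k a c 1 2 by (simp add: meet_join_distrib join_zero bzero_closed)
      finally show False
        using M_meet[OF mn(1,2)] M(3) by simp
    qed
  qed (use M M_meet in auto)
  then show thesis
    using M(1) that by blast
qed

lemma in_ultrafilter_one: "ultrafilter A F \<Longrightarrow> bone A \<in> F"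
  and in_ultrafilter_zero: "ultrafilter A F \<Longrightarrow> bzero A \<notin> F"
  and in_ultrafilter_closed: "\<lbrakk>ultrafilter A F; a \<in> F\<rbrakk> \<Longrightarrow> a \<in> car A"
  and ultrafilter_leq: "\<lbrakk>ultrafilter A F; a \<in> F; leq A a b; b \<in> car A\<rbrakk> \<Longrightarrow> b \<in> F"
  unfolding ultrafilter_def by blast+

lemma in_ultrafilter_meet:
  assumes F: "ultrafilter A F" and ab: "a \<in> car A" "b \<in> car A"
  shows "meet A a b \<in> F \<longleftrightarrow> a \<in> F \<and> b \<in> F"
proof
  assume "meet A a b \<in> F"
  then show "a \<in> F \<and> b \<in> F"
    using ultrafilter_leq[OF F _ leq_meet_left[OF ab]] ultrafilter_leq[OF F _ leq_meet_right[OF ab]] ab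
    by blast
qed (use F in \<open>auto simp: ultrafilter_def\<close>)

lemma in_ultrafilter_neg:
  assumes F: "ultrafilter A F" and a: "a \<in> car A"
  shows "neg A a \<in> F \<longleftrightarrow> a \<notin> F"
proof
  assume "neg A a \<in> F"
  then show "a \<notin> F"
    using in_ultrafilter_meet[OF F a neg_closed[OF a]] meet_neg[OF a] in_ultrafilter_zero[OF F] by auto
qed (use F a in \<open>auto simp: ultrafilter_def\<close>)

lemma in_ultrafilter_join:
  assumes F: "ultrafilter A F" and ab: "a \<in> car A" "b \<in> car A"
  shows "join A a b \<in> F \<longleftrightarrow> a \<in> F \<or> b \<in> F"
proof
  assume *: "join A a b \<in> F"
  have neg_meet: "meet A (neg A c) c = bzero A" if "c \<in> car A" for c
    using meet_neg[OF that] meet_comm[OF that neg_closed[OF that]] by simp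
  let ?n = "meet A (neg A a) (neg A b)"
  show "a \<in> F \<or> b \<in> F"
  proof (rule ccontr)
    assume "\<not> ?thesis"
    then have "?n \<in> F"
      using F ab by (simp add: in_ultrafilter_neg in_ultrafilter_meet neg_closed)
    then have "meet A ?n (join A a b) \<in> F"
      using * F ab by (simp add: in_ultrafilter_meet neg_closed join_closed meet_closed)
    moreover have "meet A ?n b = bzero A"
      using ab by (simp add: neg_meet meet_assoc meet_zero neg_closed)
    moreover have "meet A (meet A (neg A b) (neg A a)) a = bzero A"
      using ab by (simp add: neg_meet meet_assoc meet_zero neg_closed)
    then have "meet A ?n a = bzero A"
      using meet_comm[OF neg_closed[OF ab(1)] neg_closed[OF ab(2)]] by simp
    ultimately show False
      using F ab in_ultrafilter_zero
      by (simp add: meet_join_distrib closed join_zero)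
  qed
next
  assume "a \<in> F \<or> b \<in> F"
  then show "join A a b \<in> F"
    using ultrafilter_leq[OF F _ leq_join_left[OF ab] join_closed[OF ab]]
      ultrafilter_leq[OF F _ leq_join_right[OF ab] join_closed[OF ab]] by blast
qed

lemmas in_ultrafilter = in_ultrafilter_one in_ultrafilter_zero in_ultrafilter_meet
  in_ultrafilter_neg in_ultrafilter_join

lemma ultrafilter_exists:
  assumes "a \<in> car A" "a \<noteq> bzero A"
  obtains F where "ultrafilter A F" "a \<in> F"
proof -
  have "bone A \<noteq> bzero A"
    using assms meet_one[of a] meet_zero[of a] by auto
  moreover have "meet A (bone A) a = a"
    using assms meet_comm[of "bone A" a] by (simp add: bone_closed meet_one)
  ultimately obtain F where "ultrafilter A F" "{bone A, a} \<subseteq> F"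
    using assms by (elim ultrafilter_extension[of "{bone A, a}", rotated -1])
      (auto simp: bone_closed meet_one meet_idem)
  then show thesis
    using that by blast
qed

text \<open>If \<open>a\<close> is not below \<open>b\<close>, an ultrafilter through
  \<open>meet A a (neg A b)\<close> shows it. Boolean facts can therefore be checked point by
  point.\<close>

lemma leq_iff:
  assumes "a \<in> car A" "b \<in> car A"
  shows "leq A a b \<longleftrightarrow> (\<forall>F. ultrafilter A F \<longrightarrow> a \<in> F \<longrightarrow> b \<in> F)"
proof
  assume *: "\<forall>F. ultrafilter A F \<longrightarrow> a \<in> F \<longrightarrow> b \<in> F"
  have "meet A a (neg A b) = bzero A"
    using * assms ultrafilter_exists[of "meet A a (neg A b)"]
    by (metis in_ultrafilter_meet in_ultrafilter_neg meet_closed neg_closed)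
  then have "meet A a (join A b (neg A b)) = meet A a b"
    using assms by (simp add: meet_join_distrib closed join_zero)
  then show "leq A a b"
    using assms by (simp add: leq_def join_neg meet_one)
qed (use assms ultrafilter_leq in blast)

lemma ultrafilter_eqI:
  assumes "a \<in> car A" "b \<in> car A" "\<And>F. ultrafilter A F \<Longrightarrow> a \<in> F \<longleftrightarrow> b \<in> F"
  shows "a = b"
proof -
  have "leq A a b" "leq A b a"
    using assms leq_iff by auto
  then show ?thesis
    using assms by (metis leq_def meet_comm)
qed

lemma eq_zero_iff: "a \<in> car A \<Longrightarrow> a = bzero A \<longleftrightarrow> (\<forall>F. ultrafilter A F \<longrightarrow> a \<notin> F)"
  using ultrafilter_exists in_ultrafilter_zero by metis

text \<open>The Jonsson-Tarski existence argument, done once for both operators. The set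
  \<open>S\<close> is the filter generated by \<open>a\<close> and all \<open>b\<close> whose dual
  box holds at \<open>x\<close>, that is, \<open>f (neg A b) \<notin> x\<close>; any ultrafilter
  extending it is a witness.\<close>

lemma modal_witness:
  fixes f
  assumes f: "\<And>b. b \<in> car A \<Longrightarrow> f b \<in> car A" "f (bzero A) = bzero A"
      "\<And>b c. \<lbrakk>b \<in> car A; c \<in> car A\<rbrakk> \<Longrightarrow> f (join A b c) = join A (f b) (f c)"
    and x: "ultrafilter A x" and a: "a \<in> car A" "f a \<in> x"
  obtains y where "ultrafilter A y" "a \<in> y" "\<forall>b\<in>y. f b \<in> x"
proof -
  have mono: "f c \<in> x" if "b \<in> car A" "c \<in> car A" "f b \<in> x" "leq A b c" for b c
  proof -
    have "join A b c = c"
      using that by (intro ultrafilter_eqI) (auto simp: in_ultrafilter closed leq_iff)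
    then have "f c = join A (f b) (f c)"
      using that f by metis
    then show ?thesis
      using that f x by (metis in_ultrafilter_join)
  qed
  define S where "S = {s \<in> car A. \<exists>b\<in>car A. f (neg A b) \<notin> x \<and> leq A (meet A a b) s}"
  obtain y where y: "ultrafilter A y" "S \<subseteq> y"
  proof (rule ultrafilter_extension)
    show "S \<subseteq> car A"
      by (auto simp: S_def)
    have "neg A (bone A) = bzero A"
      by (intro ultrafilter_eqI) (auto simp: in_ultrafilter closed)
    then show "bone A \<in> S"
      using f(2) x a by (auto simp: S_def leq_iff in_ultrafilter closed intro!: bexI[of _ "bone A"])
    show "bzero A \<notin> S"
    proof
      assume "bzero A \<in> S"
      then obtain b where "b \<in> car A" "f (neg A b) \<notin> x" "leq A (meet A a b) (bzero A)"
        by (auto simp: S_def)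
      moreover from this have "leq A a (neg A b)"
        using a by (auto simp: leq_iff in_ultrafilter closed)
      ultimately show False
        using mono a neg_closed by metis
    qed
    show "meet A s t \<in> S" if st: "s \<in> S" "t \<in> S" for s t
    proof -
      obtain b c where bc: "b \<in> car A" "f (neg A b) \<notin> x" "leq A (meet A a b) s"
        "c \<in> car A" "f (neg A c) \<notin> x" "leq A (meet A a c) t" "s \<in> car A" "t \<in> car A"
        using st by (auto simp: S_def)
      have "neg A (meet A b c) = join A (neg A b) (neg A c)"
        using bc by (intro ultrafilter_eqI) (auto simp: in_ultrafilter closed)
      then have "f (neg A (meet A b c)) \<notin> x"
        using bc f x by (simp add: in_ultrafilter closed)
      moreover have "leq A (meet A a (meet A b c)) (meet A s t)"
        using bc a by (auto simp: leq_iff in_ultrafilter closed)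
      ultimately show ?thesis
        using bc closed by (auto simp: S_def)
    qed
  qed
  show thesis
  proof
    show "ultrafilter A y"
      by (fact y)
    have "neg A (bone A) = bzero A"
      by (intro ultrafilter_eqI) (auto simp: in_ultrafilter closed)
    then have "a \<in> S"
      using f(2) x a by (auto simp: S_def leq_iff in_ultrafilter closed intro!: bexI[of _ "bone A"])
    then show "a \<in> y"
      using y by blast
    show "\<forall>b\<in>y. f b \<in> x"
    proof (rule ballI, rule ccontr)
      fix b assume b: "b \<in> y" "f b \<notin> x"
      then have bA: "b \<in> car A"
        using y in_ultrafilter_closed by blast
      have "neg A (neg A b) = b"
        using bA by (intro ultrafilter_eqI) (auto simp: in_ultrafilter closed)
      then have "neg A b \<in> S"
        using b bA a by (auto simp: S_def leq_iff in_ultrafilter closed intro!: bexI[of _ "neg A b"])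
      then show False
        using y b bA in_ultrafilter_neg by blast
    qed
  qed
qed

section \<open>The relations of the dual frame\<close>

abbreviation R :: "('a set \<times> 'a set) set" where "R \<equiv> Rrel (dual_frame A)"
abbreviation E :: "('a set \<times> 'a set) set" where "E \<equiv> Erel (dual_frame A)"
abbreviation Q :: "('a set \<times> 'a set) set" where "Q \<equiv> Qrel (dual_frame A)"

lemma R_iff: "(x, y) \<in> R \<longleftrightarrow> ultrafilter A x \<and> ultrafilter A y \<and> (\<forall>a\<in>y. dia A a \<in> x)"
  and E_iff: "(x, y) \<in> E \<longleftrightarrow> ultrafilter A x \<and> ultrafilter A y \<and> (\<forall>a\<in>y. exi A a \<in> x)"
  by (auto simp: dual_frame_def)

lemma in_ultrafilter_dia:
  "\<lbrakk>ultrafilter A x; a \<in> car A\<rbrakk> \<Longrightarrow> dia A a \<in> x \<longleftrightarrow> (\<exists>y. (x, y) \<in> R \<and> a \<in> y)"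
  using modal_witness[of "dia A" x a] dia_closed dia_zero dia_join R_iff by metis

lemma in_ultrafilter_exi:
  "\<lbrakk>ultrafilter A x; a \<in> car A\<rbrakk> \<Longrightarrow> exi A a \<in> x \<longleftrightarrow> (\<exists>y. (x, y) \<in> E \<and> a \<in> y)"
  using modal_witness[of "exi A" x a] exi_closed exi_zero exi_join E_iff by metis

lemma R_refl: "ultrafilter A x \<Longrightarrow> (x, x) \<in> R"
  using dia_refl ultrafilter_leq in_ultrafilter_closed dia_closed unfolding R_iff by metis

lemma R_trans: "\<lbrakk>(x, y) \<in> R; (y, z) \<in> R\<rbrakk> \<Longrightarrow> (x, z) \<in> R"
  using dia_trans ultrafilter_leq in_ultrafilter_closed dia_closed unfolding R_iff by meson

lemma E_refl: "ultrafilter A x \<Longrightarrow> (x, x) \<in> E"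
  using exi_refl ultrafilter_leq in_ultrafilter_closed exi_closed unfolding E_iff by metis

lemma E_trans: "\<lbrakk>(x, y) \<in> E; (y, z) \<in> E\<rbrakk> \<Longrightarrow> (x, z) \<in> E"
  using exi_trans ultrafilter_leq in_ultrafilter_closed exi_closed unfolding E_iff by meson

lemma E_sym:
  assumes "(x, y) \<in> E"
  shows "(y, x) \<in> E"
proof -
  have xy: "ultrafilter A x" "ultrafilter A y"
    using assms E_iff by auto
  have "exi A a \<in> y" if "a \<in> x" for a
  proof (rule ccontr)
    assume "exi A a \<notin> y"
    then have "exi A (neg A (exi A a)) \<in> x"
      using assms xy that by (metis E_iff in_ultrafilter_neg in_ultrafilter_closed exi_closed)
    moreover have "neg A (exi A (neg A (exi A a))) \<in> x"
      using exi_sym that xy ultrafilter_leq in_ultrafilter_closed closed by meson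
    ultimately show False
      using that xy in_ultrafilter_neg in_ultrafilter_closed closed by meson
  qed
  then show ?thesis
    using xy E_iff by auto
qed

lemma QI: "\<lbrakk>(x, y) \<in> R; (y, z) \<in> E\<rbrakk> \<Longrightarrow> (x, z) \<in> Q"
  and QD: "(x, z) \<in> Q \<Longrightarrow> \<exists>y. (x, y) \<in> R \<and> (y, z) \<in> E"
  by (auto simp: Qrel_def)

text \<open>The composite is itself the dual relation of the operator that sends \<open>d\<close> to
  \<open>dia A (exi A d)\<close>. The hard direction needs one point \<open>w\<close> that is an
  R-successor of \<open>x\<close> and E-related to \<open>z\<close>: it extends the filter generated
  by the \<open>b\<close> that are boxed at \<open>x\<close> and by \<open>exi A d\<close> for
  \<open>d \<in> z\<close>.\<close>

lemma Q_iff: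
  "(x, z) \<in> Q \<longleftrightarrow> ultrafilter A x \<and> ultrafilter A z \<and> (\<forall>d\<in>z. dia A (exi A d) \<in> x)"
proof
  assume "(x, z) \<in> Q"
  then show "ultrafilter A x \<and> ultrafilter A z \<and> (\<forall>d\<in>z. dia A (exi A d) \<in> x)"
    by (auto simp: R_iff E_iff Qrel_def)
next
  assume *: "ultrafilter A x \<and> ultrafilter A z \<and> (\<forall>d\<in>z. dia A (exi A d) \<in> x)"
  define S where "S = {s \<in> car A. \<exists>b\<in>car A. \<exists>d\<in>z. dia A (neg A b) \<notin> x \<and> leq A (meet A b (exi A d)) s}"
  have S_I: "s \<in> S"
    if "s \<in> car A" "b \<in> car A" "d \<in> z" "dia A (neg A b) \<notin> x" "leq A (meet A b (exi A d)) s" for s b d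
    using that by (auto simp: S_def)
  have zA: "d \<in> z \<Longrightarrow> d \<in> car A" for d
    using * in_ultrafilter_closed by blast
  have neg_one: "neg A (bone A) = bzero A"
    by (intro ultrafilter_eqI) (auto simp: in_ultrafilter closed)
  have one_z: "bone A \<in> z" and nb: "dia A (neg A (bone A)) \<notin> x"
    using * neg_one by (auto simp: in_ultrafilter dia_zero)
  obtain w where w: "ultrafilter A w" "S \<subseteq> w"
  proof (rule ultrafilter_extension)
    show "S \<subseteq> car A"
      by (auto simp: S_def)
    show "bone A \<in> S"
      using one_z nb by (auto simp: S_def leq_iff in_ultrafilter closed
          intro!: bexI[of _ "bone A"])
    show "bzero A \<notin> S"
    proof
      assume "bzero A \<in> S"
      then obtain b d where bd: "b \<in> car A" "d \<in> z" "dia A (neg A b) \<notin> x"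
          "leq A (meet A b (exi A d)) (bzero A)"
        by (auto simp: S_def)
      \<comment> \<open>Consistency of \<open>S\<close>: some R-successor of \<open>x\<close>
        contains \<open>exi A d\<close>, and it contains every \<open>b\<close> that is boxed at
        \<open>x\<close>.\<close>
      obtain v where v: "(x, v) \<in> R" "exi A d \<in> v"
        using * bd zA in_ultrafilter_dia exi_closed by metis
      then have "b \<in> v"
        using * bd by (metis R_iff in_ultrafilter_neg)
      then show False
        using v bd zA by (auto simp: leq_iff in_ultrafilter closed R_iff)
    qed
    show "meet A s t \<in> S" if st: "s \<in> S" "t \<in> S" for s t
    proof -
      obtain b d c e where bc: "b \<in> car A" "d \<in> z" "dia A (neg A b) \<notin> x" "leq A (meet A b (exi A d)) s"
        "c \<in> car A" "e \<in> z" "dia A (neg A c) \<notin> x" "leq A (meet A c (exi A e)) t"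
        "s \<in> car A" "t \<in> car A"
        using st by (auto simp: S_def)
      have "neg A (meet A b c) = join A (neg A b) (neg A c)"
        using bc by (intro ultrafilter_eqI) (auto simp: in_ultrafilter closed)
      then have "dia A (neg A (meet A b c)) \<notin> x"
        using bc * by (simp add: in_ultrafilter closed dia_join)
      moreover have de: "meet A d e \<in> z"
        using bc * zA by (simp add: in_ultrafilter)
      moreover have exi_de: "exi A d \<in> F \<and> exi A e \<in> F"
        if "ultrafilter A F" "exi A (meet A d e) \<in> F" for F
        using that bc zA by (simp add: in_ultrafilter_exi closed) (auto simp: E_iff in_ultrafilter)
      moreover have "leq A (meet A (meet A b c) (exi A (meet A d e))) (meet A s t)"
        using bc zA exi_de by (auto simp: leq_iff in_ultrafilter closed)
      ultimately show ?thesis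
        using bc closed by (auto simp: S_def)
    qed
  qed
  have "(x, w) \<in> R"
    unfolding R_iff
  proof (intro conjI ballI)
    fix b assume b: "b \<in> w"
    then have bA: "b \<in> car A"
      using w in_ultrafilter_closed by blast
    show "dia A b \<in> x"
    proof (rule ccontr)
      assume "dia A b \<notin> x"
      moreover have "neg A (neg A b) = b"
        using bA by (intro ultrafilter_eqI) (auto simp: in_ultrafilter closed)
      ultimately have "neg A b \<in> S"
        using bA one_z by (intro S_I[of _ "neg A b" "bone A"]) (auto simp: leq_iff in_ultrafilter closed)
      then show False
        using w b bA in_ultrafilter_neg by blast
    qed
  qed (use * w in auto)
  moreover have "(w, z) \<in> E"
    unfolding E_iff
  proof (intro conjI ballI)
    fix d assume "d \<in> z"
    then have "exi A d \<in> S"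
      using nb zA by (intro S_I[of _ "bone A" d]) (auto simp: leq_iff in_ultrafilter closed)
    then show "exi A d \<in> w"
      using w by blast
  qed (use * w in auto)
  ultimately show "(x, z) \<in> Q"
    by (rule QI)
qed

text \<open>The frame condition of the axiom \<open>exi_dia\<close>; \<open>Q_iff\<close> reduces it
  to that axiom applied to the members of \<open>z\<close>.\<close>

lemma E_R_commute:
  assumes "(x, y) \<in> E" "(y, z) \<in> R"
  shows "(x, z) \<in> Q"
  unfolding Q_iff
proof (intro conjI ballI)
  fix d assume "d \<in> z"
  then have "exi A (dia A d) \<in> x" and d: "d \<in> car A"
    using assms in_ultrafilter_closed by (auto simp: R_iff E_iff)
  then show "dia A (exi A d) \<in> x"
    using exi_dia[OF d] assms ultrafilter_leq closed unfolding E_iff by meson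
qed (use assms in \<open>auto simp: R_iff E_iff\<close>)

lemma Q_refl: "ultrafilter A x \<Longrightarrow> (x, x) \<in> Q"
  using R_refl E_refl QI by blast

text \<open>Commuting the two middle steps collects the R-steps in front and the E-steps
  behind.\<close>

lemma Q_trans:
  assumes "(x, y) \<in> Q" "(y, z) \<in> Q"
  shows "(x, z) \<in> Q"
proof -
  obtain u v where uv: "(x, u) \<in> R" "(u, y) \<in> E" "(y, v) \<in> R" "(v, z) \<in> E"
    using QD[OF assms(1)] QD[OF assms(2)] by blast
  obtain w where w: "(u, w) \<in> R" "(w, v) \<in> E"
    using QD[OF E_R_commute[OF uv(2,3)]] by blast
  show ?thesis
    using QI[OF R_trans[OF uv(1) w(1)] E_trans[OF w(2) uv(4)]] .
qed

lemma R_imp_Q: "(x, y) \<in> R \<Longrightarrow> (x, y) \<in> Q"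
  using E_refl QI R_iff by blast

lemma E_imp_Q: "(x, y) \<in> E \<Longrightarrow> (x, y) \<in> Q"
  using R_refl QI E_iff by blast

lemma in_ultrafilter_dia_exi:
  assumes "ultrafilter A x" "a \<in> car A"
  shows "dia A (exi A a) \<in> x \<longleftrightarrow> (\<exists>y. (x, y) \<in> Q \<and> a \<in> y)"
proof
  assume "dia A (exi A a) \<in> x"
  then obtain y where "(x, y) \<in> R" "exi A a \<in> y"
    using assms in_ultrafilter_dia exi_closed by blast
  then show "\<exists>y. (x, y) \<in> Q \<and> a \<in> y"
    using assms in_ultrafilter_exi QI R_iff by meson
qed (auto simp: Q_iff)

end

section \<open>Clean clusters\<close>

text \<open>Chains are counted by their number of steps, so \<open>has_chain F n x\<close> means depth greater than \<open>n\<close>.\<close>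

primrec has_chain :: "'p frame \<Rightarrow> nat \<Rightarrow> 'p \<Rightarrow> bool" where
  "has_chain F 0 x \<longleftrightarrow> True"
| "has_chain F (Suc n) x \<longleftrightarrow> (\<exists>y. (x, y) \<in> Rrel F \<and> (y, x) \<notin> Rrel F \<and> has_chain F n y)"

text \<open>Connects the recursion with the lists that define \<open>point_depth\<close>:
  \<open>n\<close> steps visit \<open>Suc n\<close> points.\<close>

lemma has_chain_iff_strict_chain:
  assumes R: "Rrel F \<subseteq> topspace (points F) \<times> topspace (points F)" and "x \<in> topspace (points F)"
  shows "has_chain F n x \<longleftrightarrow> (\<exists>xs. strict_chain F xs \<and> length xs = Suc n \<and> hd xs = x)"
  using assms(2)
proof (induction n arbitrary: x)
  case 0
  then show ?case
    by (auto simp: strict_chain_def intro!: exI[of _ "[x]"])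
next
  case (Suc n)
  show ?case
  proof
    assume "has_chain F (Suc n) x"
    then obtain y where y: "(x, y) \<in> Rrel F" "(y, x) \<notin> Rrel F" "has_chain F n y"
      by auto
    then obtain ys where "strict_chain F ys" "length ys = Suc n" "hd ys = y"
      using Suc.IH R by blast
    then show "\<exists>xs. strict_chain F xs \<and> length xs = Suc (Suc n) \<and> hd xs = x"
      using Suc.prems y by (auto simp: strict_chain_def successively_Cons intro!: exI[of _ "x # ys"])
  next
    assume "\<exists>xs. strict_chain F xs \<and> length xs = Suc (Suc n) \<and> hd xs = x"
    then obtain ys where ys: "strict_chain F (x # ys)" "length ys = Suc n"
      by (metis length_Suc_conv list.sel(1))
    then have *: "ys \<noteq> []" "strict_chain F ys" "(x, hd ys) \<in> Rrel F" "(hd ys, x) \<notin> Rrel F"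
      by (auto simp: strict_chain_def successively_Cons)
    then have "has_chain F n (hd ys)"
      using Suc.IH ys(2) R by blast
    then show "has_chain F (Suc n) x"
      using * by auto
  qed
qed

section \<open>Depth as an open condition and its lifting along E\<close>

context ms4_algebra
begin

abbreviation chain :: "nat \<Rightarrow> 'a set \<Rightarrow> bool" where "chain \<equiv> has_chain (dual_frame A)"

lemma R_ultrafilter: "(x, y) \<in> R \<Longrightarrow> ultrafilter A x" "(x, y) \<in> R \<Longrightarrow> ultrafilter A y"
  and E_ultrafilter: "(x, y) \<in> E \<Longrightarrow> ultrafilter A x" "(x, y) \<in> E \<Longrightarrow> ultrafilter A y"
  and Q_ultrafilter: "(x, y) \<in> Q \<Longrightarrow> ultrafilter A x" "(x, y) \<in> Q \<Longrightarrow> ultrafilter A y"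
  by (auto simp: R_iff E_iff Q_iff)

lemma Q_R_trans: "\<lbrakk>(x, y) \<in> Q; (y, z) \<in> R\<rbrakk> \<Longrightarrow> (x, z) \<in> Q"
  and Q_E_trans: "\<lbrakk>(x, y) \<in> Q; (y, z) \<in> E\<rbrakk> \<Longrightarrow> (x, z) \<in> Q"
  and E_Q_trans: "\<lbrakk>(x, y) \<in> E; (y, z) \<in> Q\<rbrakk> \<Longrightarrow> (x, z) \<in> Q"
  using Q_trans R_imp_Q E_imp_Q by blast+

text \<open>Only the start of the chain changes: its first step stays strict, since a return to
  \<open>x\<close> would continue to \<open>y\<close>.\<close>

lemma chain_antimono_R:
  assumes "(x, y) \<in> R" "chain n y"
  shows "chain n x"
proof (cases n)
  case (Suc m)
  then obtain z where "(y, z) \<in> R" "(z, y) \<notin> R" "chain m z"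
    using assms(2) by auto
  then show ?thesis
    using Suc assms(1) R_trans by (metis has_chain.simps(2))
qed simp

lemma chain_mono:
  assumes "chain n x" "m \<le> n"
  shows "chain m x"
  using assms(2,1)
proof (induction rule: inc_induct)
  case (step k)
  then show ?case
    using chain_antimono_R by auto
qed

text \<open>A strict step persists nearby. Let \<open>b\<close> guarantee the rest of the chain near
  \<open>y\<close>, and let \<open>a\<close> be true at \<open>x\<close> but at no R-successor of
  \<open>y\<close>; then every point that contains \<open>a\<close> and sees a point of
  \<open>b\<close> with no R-successor in \<open>a\<close> can make such a step.\<close>

lemma chain_open:
  assumes "ultrafilter A x" "chain n x"
  obtains a where "a \<in> x" "a \<in> car A" "\<And>t. \<lbrakk>ultrafilter A t; a \<in> t\<rbrakk> \<Longrightarrow> chain n t"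
proof -
  have "\<exists>a\<in>x. \<forall>t. ultrafilter A t \<and> a \<in> t \<longrightarrow> chain n t"
    using assms
  proof (induction n arbitrary: x)
    case 0
    then show ?case
      using in_ultrafilter_one by auto
  next
    case (Suc n)
    then obtain y where y: "(x, y) \<in> R" "(y, x) \<notin> R" "chain n y"
      by auto
    then have uf: "ultrafilter A y" "ultrafilter A x"
      using R_ultrafilter by blast+
    obtain b where b: "b \<in> y" "\<And>t. \<lbrakk>ultrafilter A t; b \<in> t\<rbrakk> \<Longrightarrow> chain n t"
      using Suc.IH y uf by blast
    obtain a where a: "a \<in> x" "dia A a \<notin> y"
      using y(2) uf by (auto simp: R_iff)
    have ab: "a \<in> car A" "b \<in> car A"
      using a b uf in_ultrafilter_closed by blast+
    let ?d = "meet A b (neg A (dia A a))"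
    have d: "?d \<in> t \<longleftrightarrow> b \<in> t \<and> dia A a \<notin> t" if "ultrafilter A t" for t
      using that ab by (simp add: in_ultrafilter closed)
    have "?d \<in> car A"
      using ab closed by simp
    then have "dia A ?d \<in> x"
      using y(1) a(2) b(1) d[OF uf(1)] in_ultrafilter_dia[OF uf(2)] by blast
    then have "meet A a (dia A ?d) \<in> x"
      using a(1) ab uf(2) by (simp add: in_ultrafilter_meet closed)
    moreover have "chain (Suc n) t" if t: "ultrafilter A t" "meet A a (dia A ?d) \<in> t" for t
    proof -
      have "a \<in> t" "dia A ?d \<in> t"
        using t ab by (simp_all add: in_ultrafilter_meet closed)
      then obtain s where s: "(t, s) \<in> R" "?d \<in> s"
        using in_ultrafilter_dia[OF t(1) \<open>?d \<in> car A\<close>] by blast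
      then have "b \<in> s" "dia A a \<notin> s"
        using d R_ultrafilter by blast+
      then have "chain n s" "(s, t) \<notin> R"
        using b(2) s(1) R_ultrafilter \<open>a \<in> t\<close> R_iff by blast+
      then show ?thesis
        using s(1) by auto
    qed
    ultimately show ?case
      by blast
  qed
  then show thesis
    using that assms(1) in_ultrafilter_closed by blast
qed

definition dirty :: "'a set \<Rightarrow> bool" where
  "dirty x \<longleftrightarrow> (\<exists>y. (x, y) \<in> R \<and> (x, y) \<in> E \<and> (y, x) \<notin> R)"

text \<open>Each step from \<open>u\<close> is copied to a step from \<open>b\<close> by
  commutation. If the copy could be undone, some \<open>t'\<close> above \<open>t\<close> would lie
  in the E-class of \<open>u\<close>; as \<open>u\<close> is not dirty, \<open>t'\<close> would
  return to \<open>u\<close>, so the step from \<open>u\<close> to \<open>t\<close> would not be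
  strict.\<close>

lemma chain_E:
  assumes "(b, u) \<in> E" "chain n u" "\<And>t. (u, t) \<in> R \<Longrightarrow> \<not> dirty t"
  shows "chain n b"
  using assms
proof (induction n arbitrary: b u)
  case (Suc n)
  obtain t where t: "(u, t) \<in> R" "(t, u) \<notin> R" "chain n t"
    using Suc.prems(2) by auto
  then obtain w where w: "(b, w) \<in> R" "(w, t) \<in> E"
    using QD[OF E_R_commute[OF Suc.prems(1) t(1)]] by blast
  have "(w, b) \<notin> R"
  proof
    assume "(w, b) \<in> R"
    then have "(t, b) \<in> Q"
      using E_R_commute[OF E_sym[OF w(2)]] by blast
    then obtain t' where t': "(t, t') \<in> R" "(t', b) \<in> E"
      using QD by blast
    have "(u, t') \<in> R" "(u, t') \<in> E"
      using R_trans[OF t(1) t'(1)] E_sym[OF E_trans[OF t'(2) Suc.prems(1)]] by auto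
    moreover have "\<not> dirty u"
      using Suc.prems(3)[of u] R_refl[OF E_ultrafilter(2)[OF Suc.prems(1)]] by blast
    ultimately have "(t', u) \<in> R"
      unfolding dirty_def by blast
    then show False
      using t(2) R_trans[OF t'(1)] by blast
  qed
  moreover have "chain n w"
    using Suc.IH[OF w(2) t(3)] Suc.prems(3) R_trans[OF t(1)] by blast
  ultimately show ?case
    using w by auto
qed simp

section \<open>Casari's axiom read at a point\<close>

lemma in_ultrafilter_box:
  "\<lbrakk>ultrafilter A x; a \<in> car A\<rbrakk> \<Longrightarrow> neg A (dia A (neg A a)) \<in> x \<longleftrightarrow> (\<forall>y. (x, y) \<in> R \<longrightarrow> a \<in> y)"
  using R_ultrafilter by (simp add: in_ultrafilter_neg in_ultrafilter_dia closed)

lemma in_ultrafilter_all: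
  "\<lbrakk>ultrafilter A x; a \<in> car A\<rbrakk> \<Longrightarrow> neg A (exi A (neg A a)) \<in> x \<longleftrightarrow> (\<forall>y. (x, y) \<in> E \<longrightarrow> a \<in> y)"
  using E_ultrafilter by (simp add: in_ultrafilter_neg in_ultrafilter_exi closed)

lemma in_ultrafilter_box_all:
  assumes x: "ultrafilter A x" and a: "a \<in> car A"
  shows "neg A (dia A (neg A (neg A (exi A (neg A a))))) \<in> x \<longleftrightarrow> (\<forall>y. (x, y) \<in> Q \<longrightarrow> a \<in> y)"
    (is "?l \<longleftrightarrow> ?r")
proof -
  have "?l \<longleftrightarrow> (\<forall>w. (x, w) \<in> R \<longrightarrow> neg A (exi A (neg A a)) \<in> w)"
    using in_ultrafilter_box[OF x] a closed by simp
  also have "\<dots> \<longleftrightarrow> (\<forall>w. (x, w) \<in> R \<longrightarrow> (\<forall>y. (w, y) \<in> E \<longrightarrow> a \<in> y))"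
    using in_ultrafilter_all[OF R_ultrafilter(2) a] by blast
  also have "\<dots> \<longleftrightarrow> ?r"
    by (auto simp: Qrel_def)
  finally show ?thesis .
qed

text \<open>The axiom with value \<open>p\<close> for its variable, translated to points:
  \<open>Box\<close> followed by \<open>All\<close> quantifies over Q-successors, and the points
  \<open>v\<close> in \<open>prem\<close> are those where \<open>Box p\<close> holds. The axiom
  yields \<open>p\<close> on all Q-successors of \<open>u\<close>, of which only \<open>u\<close>
  itself is kept.\<close>

lemma MpCas_at:
  assumes ax: "satisfies A (MpCas, One)" and p: "p \<in> car A" and u: "ultrafilter A u"
    and prem: "\<And>w. \<lbrakk>(u, w) \<in> Q;
      \<And>v. \<lbrakk>(w, v) \<in> R; \<And>s. (v, s) \<in> R \<Longrightarrow> p \<in> s\<rbrakk> \<Longrightarrow> \<forall>s. (v, s) \<in> Q \<longrightarrow> p \<in> s\<rbrakk>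
      \<Longrightarrow> \<forall>s. (w, s) \<in> Q \<longrightarrow> p \<in> s"
  shows "p \<in> u"
proof -
  let ?ba = "\<lambda>a. neg A (dia A (neg A (neg A (exi A (neg A a)))))"
  let ?b = "\<lambda>a. neg A (dia A (neg A a))"
  let ?q2 = "join A (neg A (?b p)) (?ba p)"
  let ?q4 = "join A (neg A (?b ?q2)) (?ba p)"
  have q: "?b p \<in> car A" "?ba p \<in> car A"
    using p closed by simp_all
  then have q2: "?q2 \<in> car A"
    using closed by simp
  then have q3: "?b ?q2 \<in> car A"
    using closed by simp
  then have q4: "?q4 \<in> car A"
    using q closed by simp
  then have q5: "?ba ?q4 \<in> car A"
    using closed by simp
  have "eval A (\<lambda>_. p) MpCas = bone A"
    using ax p unfolding satisfies_def by auto
  then have "join A (neg A (?ba ?q4)) (?ba p) \<in> u"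
    using u by (simp add: MpCas_def Let_def in_ultrafilter_one)
  then have "?ba ?q4 \<notin> u \<or> ?ba p \<in> u"
    unfolding in_ultrafilter_join[OF u neg_closed[OF q5] q(2)] in_ultrafilter_neg[OF u q5] .
  moreover have "?ba ?q4 \<in> u"
    unfolding in_ultrafilter_box_all[OF u q4]
  proof (intro allI impI)
    fix w assume w: "(u, w) \<in> Q"
    then have uw: "ultrafilter A w"
      using Q_ultrafilter by blast
    have "?ba p \<in> w" if *: "?b ?q2 \<in> w"
      unfolding in_ultrafilter_box_all[OF uw p]
    proof (rule prem[OF w])
      fix v assume v: "(w, v) \<in> R" and vs: "\<And>s. (v, s) \<in> R \<Longrightarrow> p \<in> s"
      then have uv: "ultrafilter A v"
        using R_ultrafilter by blast
      have "?q2 \<in> v"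
        using * v unfolding in_ultrafilter_box[OF uw q2] by blast
      moreover have "?b p \<in> v"
        using vs unfolding in_ultrafilter_box[OF uv p] by blast
      ultimately have "?ba p \<in> v"
        unfolding in_ultrafilter_join[OF uv neg_closed[OF q(1)] q(2)] in_ultrafilter_neg[OF uv q(1)]
        by blast
      then show "\<forall>s. (v, s) \<in> Q \<longrightarrow> p \<in> s"
        unfolding in_ultrafilter_box_all[OF uv p] .
    qed
    then show "?q4 \<in> w"
      unfolding in_ultrafilter_join[OF uw neg_closed[OF q3] q(2)] in_ultrafilter_neg[OF uw q3]
      by blast
  qed
  ultimately have "?ba p \<in> u"
    by blast
  then show ?thesis
    unfolding in_ultrafilter_box_all[OF u p] using Q_refl[OF u] by blast
qed

section \<open>Absence of dirty points\<close>

text \<open>A dirty point that is minimal with respect to strict \<open>Q\<close>-steps; the recursion counts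
  \<open>R\<close>-chains all of whose steps are \<open>Q\<close>-strict, a count that is invariant under \<open>E\<close>.\<close>

lemma minimal_dirty:
  assumes bound: "\<And>x. \<not> chain N x" and "dirty x0"
  obtains x where "dirty x" "\<And>t. \<lbrakk>dirty t; (x, t) \<in> Q\<rbrakk> \<Longrightarrow> (t, x) \<in> Q"
proof -
  define qchain where "qchain = rec_nat (\<lambda>_. True)
    (\<lambda>n P x. \<exists>y. (x, y) \<in> R \<and> (y, x) \<notin> Q \<and> P y)"
  have qchain_Suc: "qchain (Suc n) x \<longleftrightarrow> (\<exists>y. (x, y) \<in> R \<and> (y, x) \<notin> Q \<and> qchain n y)" for n x
    by (simp add: qchain_def)
  have "qchain n x \<Longrightarrow> chain n x" for n x
  proof (induction n arbitrary: x)
    case (Suc n)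
    obtain y where "(x, y) \<in> R" "(y, x) \<notin> Q" "qchain n y"
      using Suc.prems unfolding qchain_Suc by blast
    then show ?case
      using Suc.IH[of y] R_imp_Q[of y x] by auto
  qed simp
  then have "\<not> qchain N x0"
    using bound by blast
  have qchain_E: "qchain n x" if "qchain n y" "(x, y) \<in> E" for n x y
    using that
  proof (induction n arbitrary: x y)
    case (Suc n)
    obtain z where z: "(y, z) \<in> R" "(z, y) \<notin> Q" "qchain n z"
      using Suc.prems(1) by (auto simp: qchain_Suc)
    then obtain w where w: "(x, w) \<in> R" "(w, z) \<in> E"
      using QD[OF E_R_commute[OF Suc.prems(2) z(1)]] by blast
    \<comment> \<open>A way back from \<open>w\<close> to \<open>x\<close> would extend to one from
      \<open>z\<close> to \<open>y\<close>, by an E-step at either end.\<close>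
    then have "(w, x) \<notin> Q"
      using z(2) Q_E_trans[OF E_Q_trans[OF E_sym[OF w(2)]] Suc.prems(2)] by blast
    moreover have "qchain n w"
      using Suc.IH[OF z(3) w(2)] .
    ultimately show ?case
      using w(1) unfolding qchain_Suc by blast
  qed (simp add: qchain_def)
  \<comment> \<open>Moving to a dirty \<open>t\<close> strictly Q-above \<open>x\<close> lowers the
    bound: a chain counted at \<open>t\<close> transfers to the E-related \<open>w\<close> above
    \<open>x\<close>, and the strict step from \<open>x\<close> to \<open>w\<close> makes it longer
    by one.\<close>
  have "\<exists>x. dirty x \<and> (\<forall>t. dirty t \<and> (x, t) \<in> Q \<longrightarrow> (t, x) \<in> Q)"
    if "\<not> qchain n x" "dirty x" for n x
    using that
  proof (induction n arbitrary: x)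
    case (Suc n)
    show ?case
    proof (cases "\<exists>t. dirty t \<and> (x, t) \<in> Q \<and> (t, x) \<notin> Q")
      case True
      then obtain t where t: "dirty t" "(x, t) \<in> Q" "(t, x) \<notin> Q"
        by blast
      then obtain w where w: "(x, w) \<in> R" "(w, t) \<in> E"
        using QD by blast
      then have "(w, x) \<notin> Q"
        using t(3) E_Q_trans[OF E_sym[OF w(2)]] by blast
      then have "\<not> qchain n t"
        using Suc.prems(1) w qchain_E unfolding qchain_Suc by blast
      then show ?thesis
        using Suc.IH t by blast
    qed (use Suc.prems in blast)
  qed (simp add: qchain_def)
  then show thesis
    using that \<open>\<not> qchain N x0\<close> \<open>dirty x0\<close> by blast
qed

proposition not_dirty:
  assumes ax: "satisfies A (MpCas, One)" and bound: "\<And>x. \<not> chain N x"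
  shows "\<not> dirty x0"
proof
  assume "dirty x0"
  then obtain x where x: "dirty x" and min: "\<And>t. \<lbrakk>dirty t; (x, t) \<in> Q\<rbrakk> \<Longrightarrow> (t, x) \<in> Q"
    using minimal_dirty[OF bound] by blast
  obtain y where y: "(x, y) \<in> R" "(x, y) \<in> E" "(y, x) \<notin> R"
    using x unfolding dirty_def by blast
  have ux: "ultrafilter A x"
    using R_ultrafilter(1)[OF y(1)] .
  note xx = Q_refl[OF ux]
  define P where "P n \<longleftrightarrow> (\<forall>t. (x, t) \<in> Q \<longrightarrow> \<not> chain n t)" for n
  have "\<not> P 0" "P N"
    using xx bound unfolding P_def has_chain.simps(1) by blast+
  \<comment> \<open>Since \<open>chain H\<close> means depth at least \<open>Suc H\<close>, the
    maximal depth on the Q-successors of \<open>x\<close> is \<open>Suc H\<close>, and there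
    \<open>chain H\<close> expresses full depth.\<close>
  then obtain H where "\<not> P H" "P (Suc H)"
    using exists_least_lemma[of P] by blast
  then obtain r where r: "(x, r) \<in> Q" "chain H r"
    and max: "\<And>t. (x, t) \<in> Q \<Longrightarrow> \<not> chain (Suc H) t"
    unfolding P_def by blast
  have strict: "\<not> chain H t" if "(x, s) \<in> Q" "(s, t) \<in> R" "(t, s) \<notin> R" for s t
    using max[OF that(1)] that(2,3) by auto

  text \<open>Points of maximal depth lie over a dirty one as soon as depth varies in their \<open>E\<close>-cluster;
    by minimality this carries over to the points themselves.\<close>
  have drop: "\<exists>t. (u, t) \<in> R \<and> (t, u) \<in> E \<and> \<not> chain H t"
    if u: "(x, u) \<in> Q" "chain H u" and b: "(b, u) \<in> E" "\<not> chain H b" for u b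
  proof -
    \<comment> \<open>By \<open>chain_E\<close>, loss of depth inside the E-class of
      \<open>u\<close> requires a dirty point above \<open>u\<close>. Minimality of \<open>x\<close>
      then leads from \<open>t\<close> back to \<open>x\<close>, and on to \<open>u\<close>.\<close>
    obtain t where t: "(u, t) \<in> R" "dirty t"
      using chain_E[OF b(1) u(2)] b(2) by blast
    then have "(t, u) \<in> Q"
      using min[OF t(2) Q_R_trans[OF u(1) t(1)]] Q_trans[OF _ u(1)] by blast
    then obtain s where s: "(t, s) \<in> R" "(s, u) \<in> E"
      using QD by blast
    \<comment> \<open>Either \<open>s\<close> is strictly above \<open>u\<close> and serves as the
      required point, or \<open>t\<close> and \<open>u\<close> lie in one R-cluster. In the second
      case the witness \<open>v\<close> for dirtiness of \<open>t\<close> is strictly above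
      \<open>u\<close>, and following it back into the E-class of \<open>u\<close> gives
      \<open>t'\<close>.\<close>
    show ?thesis
    proof (cases "(s, u) \<in> R")
      case False
      then show ?thesis
        using strict[OF u(1) R_trans[OF t(1) s(1)]] R_trans[OF t(1) s(1)] s(2) by blast
    next
      case True
      obtain v where v: "(t, v) \<in> R" "(t, v) \<in> E" "(v, t) \<notin> R"
        using t(2) unfolding dirty_def by blast
      have "(t, u) \<in> R"
        using R_trans[OF s(1) True] .
      then have "(v, u) \<in> Q"
        using E_R_commute[OF E_sym[OF v(2)]] by blast
      then obtain t' where t': "(v, t') \<in> R" "(t', u) \<in> E"
        using QD by blast
      then have "(u, t') \<in> R"
        using R_trans[OF R_trans[OF t(1) v(1)]] by blast
      moreover have "(t', u) \<notin> R"
        using v(3) R_trans[OF t'(1) R_trans[OF _ t(1)]] by blast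
      ultimately show ?thesis
        using strict[OF u(1)] t'(2) by blast
    qed
  qed

  \<comment> \<open>Were full depth invariant under E, it would pass from \<open>r\<close> to
    \<open>w\<close>, down to \<open>x\<close>, and across to \<open>y\<close>, which is strictly
    above \<open>x\<close>.\<close>
  have "\<exists>u b. (x, u) \<in> Q \<and> chain H u \<and> (b, u) \<in> E \<and> \<not> chain H b"
  proof (rule ccontr)
    assume "\<not> ?thesis"
    then have inv: "\<And>u b. \<lbrakk>(x, u) \<in> Q; chain H u; (b, u) \<in> E\<rbrakk> \<Longrightarrow> chain H b"
      by blast
    obtain w where w: "(x, w) \<in> R" "(w, r) \<in> E"
      using QD[OF r(1)] by blast
    then have "chain H x"
      using inv[OF r w(2)] chain_antimono_R[OF w(1)] by blast
    then have "chain H y"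
      using inv[OF xx _ E_sym[OF y(2)]] by blast
    then show False
      using strict[OF xx y(1,3)] by blast
  qed
  then obtain u b where u: "(x, u) \<in> Q" "chain H u" "(b, u) \<in> E" "\<not> chain H b"
    by blast
  have uf: "ultrafilter A u"
    using Q_ultrafilter(2)[OF u(1)] .
  obtain a where a: "a \<in> u" "a \<in> car A" and open_a: "\<And>t. \<lbrakk>ultrafilter A t; a \<in> t\<rbrakk> \<Longrightarrow> chain H t"
    using chain_open[OF uf u(2)] by blast
  \<comment> \<open>The element \<open>?d\<close> describes points with no R-successor in
    \<open>a\<close> whose E-class nevertheless meets \<open>a\<close>; \<open>?w\<close> is the
    part of \<open>a\<close> that sees such points.\<close>
  let ?d = "meet A (exi A a) (neg A (dia A a))"
  let ?w = "meet A a (dia A ?d)"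
  have w_iff: "?w \<in> t \<longleftrightarrow>
      a \<in> t \<and> (\<exists>v s. (t, v) \<in> R \<and> (v, s) \<in> E \<and> a \<in> s \<and> (\<forall>s. (v, s) \<in> R \<longrightarrow> a \<notin> s))"
    if t: "ultrafilter A t" for t
  proof -
    have d: "?d \<in> v \<longleftrightarrow> (\<exists>s. (v, s) \<in> E \<and> a \<in> s) \<and> (\<forall>s. (v, s) \<in> R \<longrightarrow> a \<notin> s)" if "ultrafilter A v" for v
      using that a by (simp add: in_ultrafilter in_ultrafilter_dia in_ultrafilter_exi closed)
    have "?d \<in> car A"
      using a closed by simp
    then have "?w \<in> t \<longleftrightarrow> a \<in> t \<and> (\<exists>v. (t, v) \<in> R \<and> ?d \<in> v)"
      using t a by (simp add: in_ultrafilter_meet in_ultrafilter_dia dia_closed)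
    then show ?thesis
      using d[OF R_ultrafilter(2)] by blast
  qed
  \<comment> \<open>The point \<open>t\<close> supplied by \<open>drop\<close> lies in
    \<open>?d\<close>: a successor of \<open>t\<close> in \<open>a\<close> would have full depth and
    pass it down to \<open>t\<close>.\<close>
  have in_w: "?w \<in> u1" if u1: "(x, u1) \<in> Q" "a \<in> u1" "(v, u1) \<in> E" "\<not> chain H v" for u1 v
  proof -
    have uf1: "ultrafilter A u1"
      using Q_ultrafilter(2)[OF u1(1)] .
    obtain t where t: "(u1, t) \<in> R" "(t, u1) \<in> E" "\<not> chain H t"
      using drop[OF u1(1) open_a[OF uf1 u1(2)] u1(3,4)] by blast
    moreover have "\<forall>s. (t, s) \<in> R \<longrightarrow> a \<notin> s"
      using t(3) open_a[OF R_ultrafilter(2)] chain_antimono_R by blast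
    ultimately show ?thesis
      using u1(2) E_sym unfolding w_iff[OF uf1] by blast
  qed
  \<comment> \<open>The value that refutes the axiom: it fails at \<open>u\<close>, which lies in
    \<open>?w\<close>, while the axiom will force it there.\<close>
  let ?p = "neg A (dia A ?w)"
  have p: "?p \<in> car A"
    using a closed by simp
  have p_iff: "?p \<in> t \<longleftrightarrow> (\<forall>s. (t, s) \<in> R \<longrightarrow> ?w \<notin> s)" if "ultrafilter A t" for t
    using that a in_ultrafilter_dia[OF that, of ?w] by (simp add: in_ultrafilter_neg closed)
  have p_R: "?p \<in> s" if "?p \<in> t" "(t, s) \<in> R" for s t
    using that R_trans[OF that(2)] p_iff[OF R_ultrafilter(1)[OF that(2)]]
      p_iff[OF R_ultrafilter(2)[OF that(2)]] by blast
  have "?p \<in> u"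
  proof (rule MpCas_at[OF ax p uf])
    fix w assume w: "(u, w) \<in> Q"
      and hyp: "\<And>v. \<lbrakk>(w, v) \<in> R; \<And>s. (v, s) \<in> R \<Longrightarrow> ?p \<in> s\<rbrakk> \<Longrightarrow> \<forall>s. (v, s) \<in> Q \<longrightarrow> ?p \<in> s"
    have uw: "ultrafilter A w"
      using Q_ultrafilter(2)[OF w] .
    \<comment> \<open>If \<open>?p\<close> fails at \<open>w\<close>, then \<open>w\<close> sees a
      point of \<open>?w\<close> and hence some \<open>v\<close> with no successor in
      \<open>a\<close>. So \<open>?p\<close> holds on all R-successors of \<open>v\<close>, and
      \<open>hyp\<close> extends it to the E-related \<open>u1\<close>; but \<open>u1\<close> lies
      in \<open>?w\<close>.\<close>
    show "\<forall>s. (w, s) \<in> Q \<longrightarrow> ?p \<in> s"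
    proof (cases "?p \<in> w")
      case True
      then show ?thesis
        using hyp[OF R_refl[OF uw]] p_R by blast
    next
      case False
      then obtain q where q: "(w, q) \<in> R" "?w \<in> q"
        using p_iff[OF uw] by blast
      have uq: "ultrafilter A q"
        using R_ultrafilter(2)[OF q(1)] .
      obtain v u1 where v: "a \<in> q" "(q, v) \<in> R" "(v, u1) \<in> E" "a \<in> u1" "\<forall>s. (v, s) \<in> R \<longrightarrow> a \<notin> s"
        using q(2) unfolding w_iff[OF uq] by blast
      have xq: "(x, q) \<in> Q"
        using Q_R_trans[OF Q_trans[OF u(1) w] q(1)] .
      have "\<not> chain H v"
        using strict[OF xq v(2)] v(1,5) by blast
      moreover have "(x, u1) \<in> Q"
        using Q_E_trans[OF Q_R_trans[OF xq v(2)] v(3)] .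
      ultimately have "?w \<in> u1"
        using in_w v(3,4) by blast
      then have "?p \<notin> u1"
        using p_iff[OF E_ultrafilter(2)[OF v(3)]] R_refl[OF E_ultrafilter(2)[OF v(3)]] by blast
      moreover have "?p \<in> v"
        using v(5) w_iff[OF R_ultrafilter(2)] unfolding p_iff[OF R_ultrafilter(2)[OF v(2)]] by blast
      then have "\<forall>s. (v, s) \<in> Q \<longrightarrow> ?p \<in> s"
        using hyp[OF R_trans[OF q(1) v(2)]] p_R by blast
      ultimately show ?thesis
        using E_imp_Q[OF v(3)] by blast
    qed
  qed
  moreover have "?w \<in> u"
    using in_w[OF u(1) a(1) u(3,4)] .
  ultimately show False
    using p_iff[OF uf] R_refl[OF uf] by blast
qed

end

section \<open>Homomorphisms, quotients and relativizations\<close>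

definition homomorphism :: "'a bimodal \<Rightarrow> 'b bimodal \<Rightarrow> ('a \<Rightarrow> 'b) \<Rightarrow> bool" where
  "homomorphism A B h \<longleftrightarrow> h ` car A \<subseteq> car B \<and> h (bzero A) = bzero B \<and> h (bone A) = bone B \<and>
    (\<forall>a\<in>car A. \<forall>b\<in>car A. h (meet A a b) = meet B (h a) (h b) \<and> h (join A a b) = join B (h a) (h b)) \<and>
    (\<forall>a\<in>car A. h (neg A a) = neg B (h a) \<and> h (dia A a) = dia B (h a) \<and> h (exi A a) = exi B (h a))"

lemma homomorphism_comp:
  assumes "homomorphism A B g" and "homomorphism B C h"
  shows "homomorphism A C (h \<circ> g)"
  using assms unfolding homomorphism_def by (simp add: image_subset_iff)

lemma (in bimodal_algebra) eval_closed: "range v \<subseteq> car A \<Longrightarrow> eval A v t \<in> car A"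
  by (induction t) (auto simp: closed)

lemma (in bimodal_algebra) eval_homomorphism:
  assumes h: "homomorphism A B h" and v: "range v \<subseteq> car A"
  shows "h (eval A v t) = eval B (h \<circ> v) t"
  by (induction t) (use h eval_closed[OF v] in \<open>simp_all add: homomorphism_def\<close>)

lemma (in bimodal_algebra) satisfies_surj_image:
  assumes h: "homomorphism A B h" and surj: "h ` car A = car B" and "satisfies A e"
  shows "satisfies B e"
  unfolding satisfies_def
proof (intro allI impI)
  fix w :: "nat \<Rightarrow> _" assume w: "range w \<subseteq> car B"
  define v where "v n = inv_into (car A) h (w n)" for n
  have "w n \<in> h ` car A" for n
    using w surj by auto
  then have "range v \<subseteq> car A" "h \<circ> v = w"
    by (auto simp: v_def inv_into_into f_inv_into_f)
  moreover from this have "eval A v (fst e) = eval A v (snd e)"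
    using assms(3) by (simp add: satisfies_def)
  ultimately show "eval B w (fst e) = eval B w (snd e)"
    using eval_homomorphism[OF h, of v] by metis
qed

lemma (in bimodal_algebra) satisfies_embedding:
  assumes h: "homomorphism A B h" and inj: "inj_on h (car A)" and B: "satisfies B e"
  shows "satisfies A e"
  unfolding satisfies_def
proof (intro allI impI)
  fix v :: "nat \<Rightarrow> _" assume v: "range v \<subseteq> car A"
  then have "range (h \<circ> v) \<subseteq> car B"
    using h by (auto simp: homomorphism_def)
  then have "h (eval A v (fst e)) = h (eval A v (snd e))"
    using B unfolding eval_homomorphism[OF h v] satisfies_def by blast
  then show "eval A v (fst e) = eval A v (snd e)"
    using inj eval_closed[OF v] by (simp add: inj_on_eq_iff)
qed

text \<open>The quotient is carried by a set of representatives, so that it lives on the same type.\<close>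

lemma variety_quotient:
  fixes V :: "'a bimodal set"
  assumes "variety V" "A \<in> V" and \<theta>: "congruence A \<theta>"
  obtains B :: "'a bimodal" and h where "B \<in> V" "homomorphism A B h" "h ` car A = car B"
    "\<And>a b. \<lbrakk>a \<in> car A; b \<in> car A\<rbrakk> \<Longrightarrow> h a = h b \<longleftrightarrow> (a, b) \<in> \<theta>"
proof -
  obtain \<Sigma> where \<Sigma>: "V = models \<Sigma>"
    using assms(1) by (auto simp: variety_def)
  interpret bimodal_algebra A
    using assms(2) \<Sigma> by (auto simp: models_def)
  \<comment> \<open>One representative per class: equal classes give the same choice, so
    \<open>h\<close> is constant on each class.\<close>
  define h where "h a = (SOME b. b \<in> \<theta> `` {a})" for a
  have eqv: "equiv (car A) \<theta>"
    using \<theta> by (simp add: congruence_def)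
  have h: "(a, h a) \<in> \<theta>" if "a \<in> car A" for a
  proof -
    have "a \<in> \<theta> `` {a}"
      using eqv that by (rule equiv_class_self)
    then have "h a \<in> \<theta> `` {a}"
      unfolding h_def by (rule someI)
    then show ?thesis
      by blast
  qed
  have h_eq: "h a = h b \<longleftrightarrow> (a, b) \<in> \<theta>" if ab: "a \<in> car A" "b \<in> car A" for a b
  proof
    assume "(a, b) \<in> \<theta>"
    then show "h a = h b"
      unfolding h_def by (simp add: equiv_class_eq[OF eqv])
  next
    assume eq: "h a = h b"
    have "(h b, b) \<in> \<theta>"
      using h[OF ab(2)] eqv by (meson equivE symD)
    then show "(a, b) \<in> \<theta>"
      using h[OF ab(1)] eq eqv by (metis equivE transD)
  qed
  have h_car: "h a \<in> car A" if "a \<in> car A" for a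
    using h[OF that] eqv by (meson equiv_class_eq_iff)
  define B :: "'a bimodal" where "B = \<lparr>car = h ` car A, meet = \<lambda>a b. h (meet A a b),
    join = \<lambda>a b. h (join A a b), neg = \<lambda>a. h (neg A a), bzero = h (bzero A), bone = h (bone A),
    dia = \<lambda>a. h (dia A a), exi = \<lambda>a. h (exi A a)\<rparr>"
  have meet_join: "(meet A a c, meet A b d) \<in> \<theta>" "(join A a c, join A b d) \<in> \<theta>"
    if "(a, b) \<in> \<theta>" "(c, d) \<in> \<theta>" for a b c d
    using \<theta> that unfolding congruence_def by blast+
  have unary: "(neg A a, neg A b) \<in> \<theta>" "(dia A a, dia A b) \<in> \<theta>" "(exi A a, exi A b) \<in> \<theta>"
    if "(a, b) \<in> \<theta>" for a b
    using \<theta> that unfolding congruence_def by blast+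
  have hom: "homomorphism A B h"
    unfolding homomorphism_def B_def using h h_car meet_join unary
    by (auto simp: h_eq closed)
  have surj: "h ` car A = car B"
    by (simp add: B_def)
  have "bimodal_algebra B"
    by unfold_locales (auto simp: B_def closed h_car)
  moreover have "\<forall>e\<in>\<Sigma>. satisfies B e"
    using assms(2) satisfies_surj_image[OF hom surj] by (auto simp: \<Sigma> models_def)
  ultimately have "B \<in> V"
    by (simp add: \<Sigma> models_def)
  then show thesis
    using that hom surj h_eq by blast
qed

section \<open>Intervals below an element and Stone duality\<close>

text \<open>The algebraic counterpart of relativization to \<open>stone A c\<close>. Since it is
  built from the operations of \<open>A\<close> and the constant \<open>c\<close>, homomorphisms
  restrict to it.\<close>

definition interval_algebra :: "'a bimodal \<Rightarrow> 'a \<Rightarrow> 'a bimodal" where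
  "interval_algebra A c = \<lparr>car = {a \<in> car A. leq A a c}, meet = meet A, join = join A,
    neg = \<lambda>a. meet A c (neg A a), bzero = bzero A, bone = c,
    dia = \<lambda>a. meet A c (dia A a), exi = \<lambda>a. meet A c (exi A a)\<rparr>"

lemma homomorphism_interval_algebra:
  assumes h: "homomorphism A B h" and A: "bimodal_algebra A" and c: "c \<in> car A"
  shows "homomorphism (interval_algebra A c) (interval_algebra B (h c)) h"
proof -
  interpret bimodal_algebra A
    by (fact A)
  have "leq B (h a) (h c)" if "a \<in> car A" "leq A a c" for a
    using h that c unfolding homomorphism_def leq_def by metis
  then show ?thesis
    using h c unfolding homomorphism_def interval_algebra_def by (auto simp: closed)
qed

context ms4_algebra
begin

lemma bimodal_interval_algebra:
  assumes c: "c \<in> car A"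
  shows "bimodal_algebra (interval_algebra A c)"
  by unfold_locales (use c in \<open>auto simp: interval_algebra_def closed leq_iff in_ultrafilter\<close>)

lemma topspace_dual_frame: "topspace (points (dual_frame A)) = {x. ultrafilter A x}"
  using in_ultrafilter_one bone_closed
  by (auto simp: dual_frame_def stone_def topology_generated_by_topspace)

lemma openin_stone: "a \<in> car A \<Longrightarrow> openin (points (dual_frame A)) (stone A a)"
  by (auto simp: dual_frame_def intro: topology_generated_by_Basis)

text \<open>The topology is only generated by the Stone sets as a subbase; they form a base because
  \<open>meet\<close> corresponds to intersection.\<close>

lemma stone_basis:
  assumes "openin (points (dual_frame A)) U" "x \<in> U"
  obtains a where "a \<in> car A" "x \<in> stone A a" "stone A a \<subseteq> U"
proof -
  have "generate_topology_on (stone A ` car A) U"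
    using assms(1) by (simp add: dual_frame_def openin_topology_generated_by_iff)
  then have "\<exists>a\<in>car A. x \<in> stone A a \<and> stone A a \<subseteq> U"
    using assms(2)
  proof (induction rule: generate_topology_on.induct)
    case (Int V W)
    then obtain a b where ab: "a \<in> car A" "x \<in> stone A a" "stone A a \<subseteq> V"
        "b \<in> car A" "x \<in> stone A b" "stone A b \<subseteq> W"
      by blast
    have "stone A (meet A a b) = stone A a \<inter> stone A b"
      using ab(1,4) in_ultrafilter_meet by (auto simp: stone_def)
    then show ?case
      using ab meet_closed by blast
  next
    case (UN K)
    then obtain k where "k \<in> K" "x \<in> k"
      by blast
    then show ?case
      using UN.IH[of k] by blast
  qed auto
  then show thesis
    using that by blast
qed

lemma stone_Compl: "a \<in> car A \<Longrightarrow> stone A (neg A a) = {x. ultrafilter A x} - stone A a"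
  using in_ultrafilter_neg by (auto simp: stone_def)

text \<open>Compactness by an ultrafilter argument. If a clopen \<open>U\<close> were no Stone set,
  the complements of all basic sets inside \<open>U\<close> or inside its complement would generate
  a proper filter, and an ultrafilter extending it would lie in no such basic set, although these
  cover the space.\<close>

lemma clopen_iff_stone:
  "clopen_in (points (dual_frame A)) U \<longleftrightarrow> (\<exists>a\<in>car A. U = stone A a)"
proof
  assume "\<exists>a\<in>car A. U = stone A a"
  then obtain a where a: "a \<in> car A" "U = stone A a"
    by blast
  then have "openin (points (dual_frame A)) (topspace (points (dual_frame A)) - U)"
    using openin_stone[OF neg_closed[OF a(1)]] by (simp add: topspace_dual_frame stone_Compl)
  moreover have "U \<subseteq> topspace (points (dual_frame A))"
    using a by (auto simp: topspace_dual_frame stone_def)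
  ultimately show "clopen_in (points (dual_frame A)) U"
    using a openin_stone by (simp add: clopen_in_def closedin_def)
next
  assume U: "clopen_in (points (dual_frame A)) U"
  let ?W = "{x. ultrafilter A x} - U"
  have op: "openin (points (dual_frame A)) U" "openin (points (dual_frame A)) ?W"
    using U by (auto simp: clopen_in_def closedin_def topspace_dual_frame)
  show "\<exists>a\<in>car A. U = stone A a"
  proof (rule ccontr)
    assume no: "\<not> ?thesis"
    define S where "S = {s \<in> car A. \<exists>a\<in>car A. \<exists>b\<in>car A. stone A a \<subseteq> U \<and> stone A b \<subseteq> ?W \<and>
      (\<forall>x. ultrafilter A x \<longrightarrow> a \<notin> x \<longrightarrow> b \<notin> x \<longrightarrow> s \<in> x)}"
    have empty: "stone A (bzero A) = {}"
      using in_ultrafilter_zero by (auto simp: stone_def)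
    obtain F where F: "ultrafilter A F" "S \<subseteq> F"
    proof (rule ultrafilter_extension)
      show "S \<subseteq> car A"
        by (auto simp: S_def)
      have "bone A \<in> x" if "ultrafilter A x" for x
        using that in_ultrafilter_one by blast
      then show "bone A \<in> S"
        unfolding S_def using empty bone_closed bzero_closed by blast
      show "bzero A \<notin> S"
      proof
        \<comment> \<open>Zero in \<open>S\<close> means that the Stone sets of \<open>a\<close> and
          \<open>b\<close> cover everything, so \<open>U\<close> would equal
          \<open>stone A a\<close>.\<close>
        assume "bzero A \<in> S"
        then obtain a b where ab: "a \<in> car A" "b \<in> car A" "stone A a \<subseteq> U" "stone A b \<subseteq> ?W"
            "\<And>x. \<lbrakk>ultrafilter A x; a \<notin> x; b \<notin> x\<rbrakk> \<Longrightarrow> bzero A \<in> x"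
          unfolding S_def by blast
        have "U \<subseteq> stone A a"
        proof
          fix x assume x: "x \<in> U"
          then have "ultrafilter A x"
            using openin_subset[OF op(1)] by (auto simp: topspace_dual_frame)
          moreover from this have "b \<notin> x"
            using ab(4) x by (auto simp: stone_def)
          ultimately show "x \<in> stone A a"
            using ab(5) in_ultrafilter_zero by (auto simp: stone_def)
        qed
        then show False
          using no ab(1,3) by blast
      qed
      show "meet A s t \<in> S" if st: "s \<in> S" "t \<in> S" for s t
      proof -
        obtain a b where ab: "a \<in> car A" "b \<in> car A" "stone A a \<subseteq> U" "stone A b \<subseteq> ?W"
            "\<And>x. \<lbrakk>ultrafilter A x; a \<notin> x; b \<notin> x\<rbrakk> \<Longrightarrow> s \<in> x" and s: "s \<in> car A"
          using st(1) unfolding S_def by blast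
        obtain a' b' where ab': "a' \<in> car A" "b' \<in> car A" "stone A a' \<subseteq> U" "stone A b' \<subseteq> ?W"
            "\<And>x. \<lbrakk>ultrafilter A x; a' \<notin> x; b' \<notin> x\<rbrakk> \<Longrightarrow> t \<in> x" and t: "t \<in> car A"
          using st(2) unfolding S_def by blast
        have "stone A (join A a a') \<subseteq> U"
          using ab(1,3) ab'(1,3) in_ultrafilter_join[of _ a a'] by (auto simp: stone_def)
        moreover have "stone A (join A b b') \<subseteq> ?W"
          using ab(2,4) ab'(2,4) in_ultrafilter_join[of _ b b'] by (auto simp: stone_def)
        moreover have "\<forall>x. ultrafilter A x \<longrightarrow> join A a a' \<notin> x \<longrightarrow> join A b b' \<notin> x \<longrightarrow> meet A s t \<in> x"
          using ab ab' s t by (auto simp: in_ultrafilter_join in_ultrafilter_meet)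
        ultimately show ?thesis
          unfolding S_def using meet_closed[OF s t] join_closed ab(1,2) ab'(1,2) by blast
      qed
    qed
    have neg_in: "neg A a \<in> F" if a: "a \<in> car A" "stone A a \<subseteq> U \<or> stone A a \<subseteq> ?W" for a
    proof -
      have "\<forall>x. ultrafilter A x \<longrightarrow> a \<notin> x \<longrightarrow> neg A a \<in> x"
        using a(1) in_ultrafilter_neg by blast
      then have "neg A a \<in> S"
        unfolding S_def using a empty bzero_closed neg_closed[OF a(1)] by blast
      then show ?thesis
        using F(2) by blast
    qed
    have "F \<in> U \<or> F \<in> ?W"
      using F(1) by blast
    then obtain a where "a \<in> car A" "F \<in> stone A a" "stone A a \<subseteq> U \<or> stone A a \<subseteq> ?W"
      using stone_basis[OF op(1)] stone_basis[OF op(2)] by metis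
    then show False
      using neg_in in_ultrafilter_neg[OF F(1)] by (auto simp: stone_def)
  qed
qed

lemma stone_subset_iff: "\<lbrakk>a \<in> car A; c \<in> car A\<rbrakk> \<Longrightarrow> stone A a \<subseteq> stone A c \<longleftrightarrow> leq A a c"
  by (auto simp: stone_def leq_iff)

lemma inj_on_stone: "inj_on (stone A) (car A)"
proof (rule inj_onI)
  fix a b assume "a \<in> car A" "b \<in> car A" "stone A a = stone A b"
  then show "a = b"
    by (intro ultrafilter_eqI) (auto simp: stone_def)
qed

text \<open>As \<open>stone A c\<close> is clopen, its relatively clopen subsets are the clopen sets
  of the whole space contained in it.\<close>

lemma car_relativization:
  assumes c: "c \<in> car A"
  shows "car (relativization A (stone A c)) = stone A ` car (interval_algebra A c)"
proof -
  let ?T = "points (dual_frame A)"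
  have "clopen_in ?T (stone A c)"
    using c clopen_iff_stone by blast
  then have "clopen_in (subtopology ?T (stone A c)) W \<longleftrightarrow> clopen_in ?T W \<and> W \<subseteq> stone A c" for W
    by (auto simp: clopen_in_def openin_open_subtopology closedin_closed_subtopology)
  then show ?thesis
    using stone_subset_iff[OF _ c]
    by (auto simp: relativization_def dual_algebra_def restrict_frame_def interval_algebra_def
        clopen_iff_stone)
qed

text \<open>With \<open>inj_on_stone\<close> and \<open>car_relativization\<close> this is an
  isomorphism. Restricting the relations to \<open>stone A c\<close> only cuts preimages down to
  \<open>c\<close>, because the sets in question already lie below \<open>c\<close>.\<close>

lemma homomorphism_stone:
  assumes c: "c \<in> car A"
  shows "homomorphism (interval_algebra A c) (relativization A (stone A c)) (stone A)"
proof -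
  have R: "(R \<inter> stone A c \<times> stone A c)\<inverse> `` stone A a = stone A (meet A c (dia A a))"
    if a: "a \<in> car A" "leq A a c" for a
  proof -
    have "(\<exists>y. (x, y) \<in> R \<and> y \<in> stone A a) \<longleftrightarrow> (\<exists>y. (x, y) \<in> R \<and> a \<in> y)" for x
      using R_ultrafilter(2) unfolding stone_def by blast
    then have "x \<in> stone A (meet A c (dia A a)) \<longleftrightarrow> x \<in> stone A c \<and> (\<exists>y. (x, y) \<in> R \<and> y \<in> stone A a)" for x
      using a c in_ultrafilter_dia[of x a]
      by (auto simp: stone_def[of A c] stone_def[of A "meet A c (dia A a)"] in_ultrafilter_meet dia_closed)
    then show ?thesis
      using a c stone_subset_iff by blast
  qed
  have E: "(E \<inter> stone A c \<times> stone A c)\<inverse> `` stone A a = stone A (meet A c (exi A a))"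
    if a: "a \<in> car A" "leq A a c" for a
  proof -
    have "(\<exists>y. (x, y) \<in> E \<and> y \<in> stone A a) \<longleftrightarrow> (\<exists>y. (x, y) \<in> E \<and> a \<in> y)" for x
      using E_ultrafilter(2) unfolding stone_def by blast
    then have "x \<in> stone A (meet A c (exi A a)) \<longleftrightarrow> x \<in> stone A c \<and> (\<exists>y. (x, y) \<in> E \<and> y \<in> stone A a)" for x
      using a c in_ultrafilter_exi[of x a]
      by (auto simp: stone_def[of A c] stone_def[of A "meet A c (exi A a)"] in_ultrafilter_meet exi_closed)
    then show ?thesis
      using a c stone_subset_iff by blast
  qed
  have top: "topspace (points (restrict_frame (dual_frame A) (stone A c))) = stone A c"
    by (auto simp: restrict_frame_def topspace_dual_frame stone_def)
  have "stone A (meet A a b) = stone A a \<inter> stone A b" "stone A (join A a b) = stone A a \<union> stone A b"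
    if "a \<in> car A" "b \<in> car A" for a b
    using that in_ultrafilter_meet in_ultrafilter_join by (auto simp: stone_def)
  moreover have "stone A (meet A c (neg A a)) = stone A c - stone A a" if "a \<in> car A" for a
    using that c by (auto simp: stone_def in_ultrafilter_meet in_ultrafilter_neg neg_closed)
  moreover have "stone A (bzero A) = {}"
    using in_ultrafilter_zero by (auto simp: stone_def)
  ultimately show ?thesis
    unfolding homomorphism_def using car_relativization[OF c] R E
    by (simp add: relativization_def dual_algebra_def top)
      (simp add: interval_algebra_def restrict_frame_def)
qed

lemma satisfies_relativization:
  assumes c: "c \<in> car A"
  shows "satisfies (interval_algebra A c) e \<Longrightarrow> satisfies (relativization A (stone A c)) e"
  using bimodal_algebra.satisfies_surj_image[OF bimodal_interval_algebra[OF c] homomorphism_stone[OF c]]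
    car_relativization[OF c] by simp

definition point_congruence :: "'a set set \<Rightarrow> ('a \<times> 'a) set" where
  "point_congruence Y = {(a, b). a \<in> car A \<and> b \<in> car A \<and> (\<forall>t\<in>Y. a \<in> t \<longleftrightarrow> b \<in> t)}"

text \<open>Whether \<open>dia A a\<close> or \<open>exi A a\<close> belongs to a point of
  \<open>Y\<close> depends only on its R- or E-successors, and these stay in the Q-upset
  \<open>Y\<close>.\<close>

lemma congruence_point_congruence:
  assumes Y: "\<And>t. t \<in> Y \<Longrightarrow> ultrafilter A t" and upset: "\<And>t s. \<lbrakk>t \<in> Y; (t, s) \<in> Q\<rbrakk> \<Longrightarrow> s \<in> Y"
  shows "congruence A (point_congruence Y)"
proof -
  let ?C = "point_congruence Y"
  have I: "(a, b) \<in> ?C" if "a \<in> car A" "b \<in> car A" "\<And>t. t \<in> Y \<Longrightarrow> a \<in> t \<longleftrightarrow> b \<in> t" for a b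
    using that by (simp add: point_congruence_def)
  have D: "a \<in> car A" "b \<in> car A" "\<And>t. t \<in> Y \<Longrightarrow> a \<in> t \<longleftrightarrow> b \<in> t" if "(a, b) \<in> ?C" for a b
    using that by (simp_all add: point_congruence_def)
  have "?C \<subseteq> car A \<times> car A"
    by (auto simp: point_congruence_def)
  moreover have "refl_on (car A) ?C" "sym ?C" "trans ?C"
    by (auto simp: point_congruence_def refl_on_def sym_def trans_def)
  ultimately have "equiv (car A) ?C"
    by (simp add: equiv_def)
  moreover have "(neg A a, neg A b) \<in> ?C \<and> (dia A a, dia A b) \<in> ?C \<and> (exi A a, exi A b) \<in> ?C"
    if ab: "(a, b) \<in> ?C" for a b
  proof (intro conjI I)
    fix t assume t: "t \<in> Y"
    note c = D(1,2)[OF ab] and eq = D(3)[OF ab]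
    show "neg A a \<in> t \<longleftrightarrow> neg A b \<in> t"
      using eq[OF t] by (simp add: in_ultrafilter_neg[OF Y[OF t]] c)
    have "\<And>y. (t, y) \<in> R \<Longrightarrow> a \<in> y \<longleftrightarrow> b \<in> y"
      using eq[OF upset[OF t R_imp_Q]] by blast
    then show "dia A a \<in> t \<longleftrightarrow> dia A b \<in> t"
      unfolding in_ultrafilter_dia[OF Y[OF t] c(1)] in_ultrafilter_dia[OF Y[OF t] c(2)] by blast
    have "\<And>y. (t, y) \<in> E \<Longrightarrow> a \<in> y \<longleftrightarrow> b \<in> y"
      using eq[OF upset[OF t E_imp_Q]] by blast
    then show "exi A a \<in> t \<longleftrightarrow> exi A b \<in> t"
      unfolding in_ultrafilter_exi[OF Y[OF t] c(1)] in_ultrafilter_exi[OF Y[OF t] c(2)] by blast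
  qed (simp_all add: closed D(1,2)[OF ab])
  moreover have "(meet A a c, meet A b d) \<in> ?C \<and> (join A a c, join A b d) \<in> ?C"
    if ab: "(a, b) \<in> ?C" and cd: "(c, d) \<in> ?C" for a b c d
  proof (intro conjI I)
    fix t assume t: "t \<in> Y"
    show "meet A a c \<in> t \<longleftrightarrow> meet A b d \<in> t" "join A a c \<in> t \<longleftrightarrow> join A b d \<in> t"
      using D(3)[OF ab t] D(3)[OF cd t]
      by (simp_all add: in_ultrafilter_meet[OF Y[OF t]] in_ultrafilter_join[OF Y[OF t]] D(1,2)[OF ab] D(1,2)[OF cd])
  qed (simp_all add: closed D(1,2)[OF ab] D(1,2)[OF cd])
  ultimately show ?thesis
    unfolding congruence_def by blast
qed

section \<open>Subdirect irreducibility and the bottom layer\<close>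

text \<open>An elementwise form of subdirect irreducibility; on the frame it says that the points of
  the nonempty clopen set of \<open>c\<close> are Q-roots.\<close>

definition opremum :: "'a \<Rightarrow> bool" where
  "opremum c \<longleftrightarrow> c \<in> car A \<and> c \<noteq> bzero A \<and> (\<forall>b\<in>car A. b \<noteq> bzero A \<longrightarrow> leq A c (dia A (exi A b)))"

lemma mem_point_congruence:
  "(a, b) \<in> point_congruence Y \<longleftrightarrow> a \<in> car A \<and> b \<in> car A \<and> (\<forall>t\<in>Y. a \<in> t \<longleftrightarrow> b \<in> t)"
  by (simp add: point_congruence_def)

lemma leq_dia_exi:
  assumes "a \<in> car A" "ultrafilter A t" "a \<in> t"
  shows "dia A (exi A a) \<in> t"
  using assms in_ultrafilter_dia_exi Q_refl by blast

text \<open>By transitivity, the points with no Q-successor in \<open>b\<close> form a Q-upset. The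
  resulting congruence identifies \<open>b\<close> with zero.\<close>

lemma congruence_collapse:
  assumes b: "b \<in> car A"
  shows "congruence A (point_congruence {t. ultrafilter A t \<and> dia A (exi A b) \<notin> t})"
proof (rule congruence_point_congruence)
  fix t s assume t: "t \<in> {t. ultrafilter A t \<and> dia A (exi A b) \<notin> t}" and ts: "(t, s) \<in> Q"
  have ut: "ultrafilter A t" and s: "ultrafilter A s"
    using Q_ultrafilter[OF ts] .
  have "dia A (exi A b) \<notin> s"
    using t Q_trans[OF ts]
    unfolding in_ultrafilter_dia_exi[OF s b] mem_Collect_eq in_ultrafilter_dia_exi[OF ut b] by blast
  then show "s \<in> {t. ultrafilter A t \<and> dia A (exi A b) \<notin> t}"
    using s by blast
qed blast

lemma collapse_mem:
  assumes b: "b \<in> car A"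
  shows "(b, bzero A) \<in> point_congruence {t. ultrafilter A t \<and> dia A (exi A b) \<notin> t}"
  using leq_dia_exi[OF b] b in_ultrafilter_zero bzero_closed unfolding mem_point_congruence by blast

text \<open>Take the symmetric difference of two distinct elements identified by the least
  congruence. Collapsing a nonzero \<open>b\<close> identifies them too, so they differ only at
  points of \<open>dia A (exi A b)\<close>.\<close>

lemma opremum_exists:
  assumes "subdirectly_irreducible A"
  obtains c where "opremum c"
proof -
  obtain \<mu> where \<mu>: "congruence A \<mu>" "\<mu> \<noteq> Id_on (car A)"
    and least: "\<And>\<theta>. \<lbrakk>congruence A \<theta>; \<theta> \<noteq> Id_on (car A)\<rbrakk> \<Longrightarrow> \<mu> \<subseteq> \<theta>"
    using assms unfolding subdirectly_irreducible_def by blast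
  have eqv: "equiv (car A) \<mu>"
    using \<mu>(1) by (simp add: congruence_def)
  have "Id_on (car A) \<subseteq> \<mu>"
    using equiv_class_self[OF eqv] by (auto simp: Id_on_def)
  then obtain p q where pq: "(p, q) \<in> \<mu>" "(p, q) \<notin> Id_on (car A)"
    using \<mu>(2) by auto
  have c: "p \<in> car A" "q \<in> car A"
    using pq(1) equiv_class_eq_iff[OF eqv] by blast+
  then have ne: "p \<noteq> q"
    using pq(2) by auto
  let ?c = "join A (meet A p (neg A q)) (meet A q (neg A p))"
  have in_c: "?c \<in> t \<longleftrightarrow> \<not> (p \<in> t \<longleftrightarrow> q \<in> t)" if "ultrafilter A t" for t
    using that c by (auto simp: in_ultrafilter closed)
  have cc: "?c \<in> car A"
    using c closed by simp
  have "?c \<noteq> bzero A"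
    using ultrafilter_eqI[OF c] ne in_c unfolding eq_zero_iff[OF cc] by blast
  moreover have "leq A ?c (dia A (exi A b))" if b: "b \<in> car A" "b \<noteq> bzero A" for b
  proof -
    let ?\<theta> = "point_congruence {t. ultrafilter A t \<and> dia A (exi A b) \<notin> t}"
    have "?\<theta> \<noteq> Id_on (car A)"
      using collapse_mem[OF b(1)] b(2) by auto
    then have "(p, q) \<in> ?\<theta>"
      using least[OF congruence_collapse[OF b(1)]] pq(1) by blast
    then show ?thesis
      using in_c unfolding leq_iff[OF cc dia_closed[OF exi_closed[OF b(1)]]] mem_point_congruence by blast
  qed
  ultimately show thesis
    using that cc unfolding opremum_def by blast
qed

text \<open>The least nontrivial congruence is the collapse of \<open>c\<close>. Any other
  nontrivial one sends some nonzero \<open>b\<close> to zero, hence also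
  \<open>dia A (exi A b)\<close>, the element \<open>c\<close> below it, and finally
  \<open>?d\<close>.\<close>

lemma opremum_subdirectly_irreducible:
  assumes "opremum c"
  shows "subdirectly_irreducible A"
proof -
  have c: "c \<in> car A" "c \<noteq> bzero A"
    and least: "\<And>b. \<lbrakk>b \<in> car A; b \<noteq> bzero A\<rbrakk> \<Longrightarrow> leq A c (dia A (exi A b))"
    using assms by (auto simp: opremum_def)
  let ?d = "dia A (exi A c)"
  have d: "?d \<in> car A"
    using c closed by simp
  define \<mu> where "\<mu> = point_congruence {t. ultrafilter A t \<and> ?d \<notin> t}"
  have "congruence A \<mu>"
    unfolding \<mu>_def by (rule congruence_collapse[OF c(1)])
  moreover have "\<mu> \<noteq> Id_on (car A)"
    using collapse_mem[OF c(1)] c(2) unfolding \<mu>_def by auto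
  moreover have "\<mu> \<subseteq> \<theta>" if \<theta>: "congruence A \<theta>" "\<theta> \<noteq> Id_on (car A)" for \<theta>
  proof -
    have eqv: "equiv (car A) \<theta>"
      using \<theta>(1) by (simp add: congruence_def)
    have refl: "(a, a) \<in> \<theta>" if "a \<in> car A" for a
      using equiv_class_self[OF eqv that] by blast
    have sym: "(b, a) \<in> \<theta>" if "(a, b) \<in> \<theta>" for a b
      using that eqv by (auto simp: equiv_def dest: symD)
    have trans: "(a, b) \<in> \<theta>" if "(a, e) \<in> \<theta>" "(e, b) \<in> \<theta>" for a b e
      using that eqv by (auto simp: equiv_def dest: transD)
    have meet: "(meet A a b, meet A a' b') \<in> \<theta>" and join: "(join A a b, join A a' b') \<in> \<theta>"
      if "(a, a') \<in> \<theta>" "(b, b') \<in> \<theta>" for a b a' b'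
      using \<theta>(1) that unfolding congruence_def by blast+
    have dia_exi: "(dia A (exi A a), dia A (exi A b)) \<in> \<theta>" if "(a, b) \<in> \<theta>" for a b
      using \<theta>(1) that unfolding congruence_def by blast
    have "Id_on (car A) \<subseteq> \<theta>"
      using refl by auto
    then obtain p q where pq: "(p, q) \<in> \<theta>" "(p, q) \<notin> Id_on (car A)"
      using \<theta>(2) by auto
    have pqA: "p \<in> car A" "q \<in> car A"
      using pq(1) equiv_class_eq_iff[OF eqv] by blast+
    then have ne: "p \<noteq> q"
      using pq(2) by auto
    obtain b where b: "(b, bzero A) \<in> \<theta>" "b \<in> car A" "b \<noteq> bzero A"
    proof -
      have *: "(meet A r (neg A s), bzero A) \<in> \<theta>" if "(r, s) \<in> \<theta>" "r \<in> car A" "s \<in> car A" for r s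
        using meet[OF that(1) refl[OF neg_closed[OF that(3)]]] meet_neg[OF that(3)] by simp
      have "meet A p (neg A q) \<noteq> bzero A \<or> meet A q (neg A p) \<noteq> bzero A"
      proof (rule ccontr)
        assume "\<not> ?thesis"
        then have "\<not> (p \<in> t \<and> q \<notin> t)" "\<not> (q \<in> t \<and> p \<notin> t)" if "ultrafilter A t" for t
          using in_ultrafilter_meet[OF that pqA(1) neg_closed[OF pqA(2)]]
            in_ultrafilter_meet[OF that pqA(2) neg_closed[OF pqA(1)]]
            in_ultrafilter_zero[OF that] in_ultrafilter_neg[OF that pqA(1)] in_ultrafilter_neg[OF that pqA(2)]
          by simp_all
        then show False
          using ultrafilter_eqI[OF pqA] ne by blast
      qed
      then show thesis
        using that[OF *[OF pq(1) pqA] meet_closed[OF pqA(1) neg_closed[OF pqA(2)]]]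
          that[OF *[OF sym[OF pq(1)] pqA(2,1)] meet_closed[OF pqA(2) neg_closed[OF pqA(1)]]] by blast
    qed
    have dz: "dia A (exi A (bzero A)) = bzero A"
      by (simp add: exi_zero dia_zero)
    have "(meet A c (dia A (exi A b)), meet A c (bzero A)) \<in> \<theta>"
      using meet[OF refl[OF c(1)] dia_exi[OF b(1)]] dz by simp
    then have "(c, bzero A) \<in> \<theta>"
      using least[OF b(2,3)] meet_zero[OF c(1)] by (simp add: leq_def)
    then have d\<theta>: "(?d, bzero A) \<in> \<theta>"
      using dia_exi[of c "bzero A"] dz by simp
    \<comment> \<open>Modulo \<open>\<theta>\<close>, cutting away \<open>?d\<close> changes no
      element, so elements that agree outside \<open>?d\<close> become identified.\<close>
    have collapse: "(x, meet A x (neg A ?d)) \<in> \<theta>" if x: "x \<in> car A" for x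
    proof -
      let ?e = "meet A x (neg A ?d)"
      have "(join A (meet A x ?d) ?e, join A (meet A x (bzero A)) ?e) \<in> \<theta>"
        using x d by (intro join meet refl d\<theta>) (simp_all add: closed)
      moreover have "join A (meet A x ?d) ?e = x" "join A (meet A x (bzero A)) ?e = ?e"
        using x d by (auto intro!: ultrafilter_eqI simp: in_ultrafilter closed)
      ultimately show ?thesis
        by simp
    qed
    show ?thesis
    proof (rule subrelI)
      fix x y assume xy: "(x, y) \<in> \<mu>"
      then have xyA: "x \<in> car A" "y \<in> car A"
        by (auto simp: \<mu>_def mem_point_congruence)
      have "meet A x (neg A ?d) = meet A y (neg A ?d)"
      proof (rule ultrafilter_eqI)
        fix t assume t: "ultrafilter A t"
        then have "?d \<in> t \<or> (x \<in> t \<longleftrightarrow> y \<in> t)"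
          using xy by (auto simp: \<mu>_def mem_point_congruence)
        then show "meet A x (neg A ?d) \<in> t \<longleftrightarrow> meet A y (neg A ?d) \<in> t"
          using t xyA d by (auto simp: in_ultrafilter_meet in_ultrafilter_neg neg_closed)
      qed (use xyA d closed in simp_all)
      then show "(x, y) \<in> \<theta>"
        using trans[OF collapse[OF xyA(1)]] sym[OF collapse[OF xyA(2)]] by simp
    qed
  qed
  ultimately show ?thesis
    unfolding subdirectly_irreducible_def by blast
qed

section \<open>Q-roots and Q-clusters\<close>

abbreviation roots :: "'a set set" where
  "roots \<equiv> {r. ultrafilter A r \<and> (\<forall>t. ultrafilter A t \<longrightarrow> (r, t) \<in> Q)}"

lemma opremum_root:
  assumes "opremum c" "ultrafilter A r" "c \<in> r"
  shows "r \<in> roots"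
proof -
  have "(r, t) \<in> Q" if t: "ultrafilter A t" for t
    unfolding Q_iff
  proof (intro conjI ballI)
    fix d assume d: "d \<in> t"
    then have dA: "d \<in> car A"
      using in_ultrafilter_closed t by blast
    have "d \<noteq> bzero A"
      using d t in_ultrafilter_zero by blast
    then have "leq A c (dia A (exi A d))"
      using assms(1) dA by (auto simp: opremum_def)
    then show "dia A (exi A d) \<in> r"
      using ultrafilter_leq[OF assms(2,3) _ dia_closed[OF exi_closed[OF dA]]] by blast
  qed (use assms t in auto)
  then show ?thesis
    using assms(2) by blast
qed

text \<open>A point that sees \<open>c\<close> sees a root and is thus a root; conversely a root
  sees every point, in particular one of \<open>c\<close>. So the set of roots is clopen.\<close>

lemma roots_eq_stone:
  assumes "opremum c"
  shows "roots = stone A (dia A (exi A c))"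
proof -
  have c: "c \<in> car A"
    using assms by (simp add: opremum_def)
  obtain r where r: "ultrafilter A r" "c \<in> r"
    using assms ultrafilter_exists[of c] by (auto simp: opremum_def)
  show ?thesis
  proof (rule set_eqI)
    fix x
    show "x \<in> roots \<longleftrightarrow> x \<in> stone A (dia A (exi A c))"
    proof
      assume "x \<in> roots"
      then have "ultrafilter A x" "(x, r) \<in> Q"
        using r(1) by blast+
      then show "x \<in> stone A (dia A (exi A c))"
        using r(2) in_ultrafilter_dia_exi[OF _ c] unfolding stone_def by blast
    next
      assume "x \<in> stone A (dia A (exi A c))"
      then obtain s where s: "ultrafilter A x" "(x, s) \<in> Q" "c \<in> s"
        using in_ultrafilter_dia_exi[OF _ c] unfolding stone_def by blast
      then have "s \<in> roots"
        using opremum_root[OF assms Q_ultrafilter(2)[OF s(2)]] by blast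
      then show "x \<in> roots"
        using s(1) Q_trans[OF s(2)] by blast
    qed
  qed
qed

lemma Q_cluster_iff:
  "Q_cluster (dual_frame A) C \<longleftrightarrow> (\<exists>x. ultrafilter A x \<and> C = {y. (x, y) \<in> Q \<and> (y, x) \<in> Q})"
proof -
  have "(Q \<inter> Q\<inverse>) `` {x} = {y. (x, y) \<in> Q \<and> (y, x) \<in> Q}" for x
    by auto
  then show ?thesis
    unfolding Q_cluster_def quotient_def topspace_dual_frame by blast
qed

text \<open>Whatever sees a root is a root, so the cluster of \<open>r\<close> contains every root
  and nothing else.\<close>

lemma Q_cluster_roots:
  assumes "r \<in> roots"
  shows "Q_cluster (dual_frame A) roots"
proof -
  have r: "ultrafilter A r" "\<And>t. ultrafilter A t \<Longrightarrow> (r, t) \<in> Q"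
    using assms by blast+
  have "y \<in> roots" if "(y, r) \<in> Q" for y
    using Q_ultrafilter(1)[OF that] Q_trans[OF that r(2)] by blast
  then have "roots = {y. (r, y) \<in> Q \<and> (y, r) \<in> Q}"
    using r by blast
  with r(1) show ?thesis
    unfolding Q_cluster_iff by (intro exI[of _ r] conjI)
qed

section \<open>Depth and the bottom layer\<close>

text \<open>The supremum exceeds \<open>n\<close> iff some list in it is longer than
  \<open>n\<close>, and \<open>chain_mono\<close> shortens such a chain to exactly
  \<open>Suc n\<close> points.\<close>

lemma less_point_depth_iff:
  assumes x: "ultrafilter A x"
  shows "enat n < point_depth (dual_frame A) x \<longleftrightarrow> chain n x"
proof -
  have *: "chain m x \<longleftrightarrow> (\<exists>xs. strict_chain (dual_frame A) xs \<and> length xs = Suc m \<and> hd xs = x)" for m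
    using x R_ultrafilter by (intro has_chain_iff_strict_chain) (auto simp: topspace_dual_frame)
  have "enat n < point_depth (dual_frame A) x \<longleftrightarrow>
      (\<exists>xs. strict_chain (dual_frame A) xs \<and> xs \<noteq> [] \<and> hd xs = x \<and> n < length xs)"
    by (auto simp: point_depth_def less_SUP_iff)
  also have "\<dots> \<longleftrightarrow> chain n x"
  proof
    assume "\<exists>xs. strict_chain (dual_frame A) xs \<and> xs \<noteq> [] \<and> hd xs = x \<and> n < length xs"
    then obtain xs where xs: "strict_chain (dual_frame A) xs" "hd xs = x" "n < length xs"
      by blast
    then obtain m where "length xs = Suc m" "n \<le> m"
      by (metis less_Suc_eq_le less_imp_Suc_add)
    then show "chain n x"
      using xs chain_mono[of m x n] * by blast
  next
    assume "chain n x"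
    then obtain xs where "strict_chain (dual_frame A) xs" "length xs = Suc n" "hd xs = x"
      using * by blast
    then show "\<exists>xs. strict_chain (dual_frame A) xs \<and> xs \<noteq> [] \<and> hd xs = x \<and> n < length xs"
      by (intro exI[of _ xs]) auto
  qed
  finally show ?thesis .
qed

lemma point_depth_le_depth:
  "ultrafilter A x \<Longrightarrow> point_depth (dual_frame A) x \<le> depth A"
  unfolding depth_def topspace_dual_frame by (auto intro: SUP_upper)

text \<open>Without dirty points chains lift along Q, so roots have maximal depth. Conversely, a
  point \<open>t\<close> of maximal depth is E-related to some \<open>w\<close> above
  \<open>r\<close> of the same depth; the step from \<open>r\<close> to \<open>w\<close> cannot be
  strict, so \<open>t\<close> sees \<open>r\<close>.\<close>

proposition bottom_layer_eq_roots:
  assumes ax: "satisfies A (MpCas, One)" and fin: "depth A \<le> enat N" and r: "r \<in> roots"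
  shows "layer (dual_frame A) (depth A) = roots"
proof -
  let ?pd = "point_depth (dual_frame A)"
  have "\<not> chain (Suc N) x" for x
  proof
    assume *: "chain (Suc N) x"
    then have x: "ultrafilter A x"
      using R_ultrafilter(1) by auto
    have "enat (Suc N) < depth A"
      using less_le_trans[OF less_point_depth_iff[OF x, THEN iffD2, OF *] point_depth_le_depth[OF x]] .
    then show False
      using less_le_trans[OF _ fin] by fastforce
  qed
  then have clean: "\<not> dirty x" for x
    using not_dirty[OF ax] by blast
  have chain_Q: "chain n x" if xy: "(x, y) \<in> Q" "chain n y" for n x y
  proof -
    obtain w where w: "(x, w) \<in> R" "(w, y) \<in> E"
      using QD[OF xy(1)] by blast
    then show ?thesis
      using chain_antimono_R[OF w(1) chain_E[OF w(2) xy(2)]] clean by blast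
  qed
  have mono: "?pd x \<le> ?pd s" if s: "s \<in> roots" and x: "ultrafilter A x" for s x
  proof (rule ccontr)
    assume "\<not> ?thesis"
    then have lt: "?pd s < ?pd x"
      by simp
    then obtain k where k: "?pd s = enat k"
      by (cases "?pd s") auto
    then have "chain k x"
      using lt less_point_depth_iff[OF x] by simp
    moreover have s': "ultrafilter A s" "(s, x) \<in> Q"
      using s x by blast+
    ultimately have "chain k s"
      using chain_Q by blast
    then show False
      using k less_point_depth_iff[OF s'(1), of k] by simp
  qed
  have depth: "depth A = ?pd s" if s: "s \<in> roots" for s
  proof (rule antisym)
    show "depth A \<le> ?pd s"
      unfolding depth_def topspace_dual_frame using mono[OF s] by (auto intro: SUP_least)
    show "?pd s \<le> depth A"
      using point_depth_le_depth s by blast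
  qed
  have "t \<in> roots" if t: "ultrafilter A t" "?pd t = depth A" for t
  proof -
    have r': "ultrafilter A r" "\<And>t. ultrafilter A t \<Longrightarrow> (r, t) \<in> Q"
      using r by blast+
    obtain k where k: "depth A = enat k"
      using fin by (cases "depth A") auto
    \<comment> \<open>The one-point chain makes the depth positive; once it is written as
      \<open>Suc m\<close>, having full depth means \<open>chain m\<close>.\<close>
    have "enat 0 < depth A"
      using less_point_depth_iff[OF t(1), of 0] t(2) by simp
    then obtain m where m: "depth A = enat (Suc m)"
      using k by (cases k) auto
    have chain_t: "chain m t"
      using less_point_depth_iff[OF t(1), of m] t(2) m by simp
    obtain w where w: "(r, w) \<in> R" "(w, t) \<in> E"
      using QD[of r t] r' t(1) by blast
    have "chain m w"
      using chain_E[OF w(2) chain_t] clean by blast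
    moreover have "\<not> chain (Suc m) r"
      using less_point_depth_iff[OF r'(1), of "Suc m"] depth[OF r] m by simp
    ultimately have "(w, r) \<in> R"
      using w(1) by auto
    then have "(t, r) \<in> Q"
      using E_R_commute[OF E_sym[OF w(2)]] by blast
    then show ?thesis
      using t(1) Q_trans[OF _ r'(2)] by blast
  qed
  then show ?thesis
    unfolding layer_def topspace_dual_frame using depth[symmetric] by blast
qed

corollary bottom_algebra_opremum:
  assumes "satisfies A (MpCas, One)" and "depth A \<le> enat N" and c: "opremum c"
  shows "bottom_algebra A = relativization A (stone A (dia A (exi A c)))"
proof -
  obtain r where "ultrafilter A r" "c \<in> r"
    using c ultrafilter_exists[of c] by (auto simp: opremum_def)
  then have "r \<in> roots"
    using opremum_root[OF c] by blast
  then show ?thesis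
    unfolding bottom_algebra_def using bottom_layer_eq_roots[OF assms(1,2)] roots_eq_stone[OF c] by simp
qed

end

section \<open>Comparison of the two generating classes\<close>

text \<open>The easy half of the comparison: the bottom layer of a subdirectly irreducible algebra
  is its set of roots, which is a clopen Q-cluster.\<close>

lemma bottom_algebra_is_cluster_relativization:
  assumes "A \<in> MpS4" and "depth A \<le> enat N" and "subdirectly_irreducible A"
  obtains U where "clopen_in (points (dual_frame A)) U" "Q_cluster (dual_frame A) U"
    "bottom_algebra A = relativization A U"
proof -
  interpret ms4_algebra A
    using assms(1) by (simp add: MpS4_def)
  have ax: "satisfies A (MpCas, One)"
    using assms(1) by (simp add: MpS4_def)
  obtain c where c: "opremum c"
    using opremum_exists[OF assms(3)] .
  have cA: "c \<in> car A" "c \<noteq> bzero A"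
    using c by (auto simp: opremum_def)
  obtain r where "ultrafilter A r" "c \<in> r"
    using ultrafilter_exists[OF cA] .
  then have r: "r \<in> roots"
    using opremum_root[OF c] by blast
  show thesis
  proof
    show "clopen_in (points (dual_frame A)) (stone A (dia A (exi A c)))"
      unfolding clopen_iff_stone using dia_closed[OF exi_closed[OF cA(1)]] by blast
    show "Q_cluster (dual_frame A) (stone A (dia A (exi A c)))"
      using Q_cluster_roots[OF r] unfolding roots_eq_stone[OF c] .
    show "bottom_algebra A = relativization A (stone A (dia A (exi A c)))"
      by (rule bottom_algebra_opremum[OF ax assms(2) c])
  qed
qed

text \<open>For the \<open>Q\<close>-upset \<open>Y\<close> generated by the cluster, the quotient of \<open>A\<close> dual to \<open>Y\<close> is subdirectly
  irreducible with the cluster as its set of roots, and it has the same relativization to it.\<close>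

lemma cluster_relativization_satisfies:
  fixes V :: "'a bimodal set"
  assumes V: "variety V" "V \<subseteq> MpS4" "\<And>A. A \<in> V \<Longrightarrow> depth A \<le> enat N"
    and A: "A \<in> V" and U: "clopen_in (points (dual_frame A)) U" "Q_cluster (dual_frame A) U"
    and e: "\<And>B. \<lbrakk>B \<in> V; subdirectly_irreducible B\<rbrakk> \<Longrightarrow> satisfies (bottom_algebra B) e"
  shows "satisfies (relativization A U) e"
proof -
  interpret A: ms4_algebra A
    using A V(2) by (auto simp: MpS4_def)
  obtain c where c: "c \<in> car A" "U = stone A c"
    using U(1) A.clopen_iff_stone by blast
  obtain x where x: "ultrafilter A x" "U = {y. (x, y) \<in> A.Q \<and> (y, x) \<in> A.Q}"
    using U(2) A.Q_cluster_iff by blast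
  have c_iff: "c \<in> t \<longleftrightarrow> (x, t) \<in> A.Q \<and> (t, x) \<in> A.Q" if "ultrafilter A t" for t
    using c(2) x(2) that unfolding stone_def by blast
  have cx: "c \<in> x"
    using c_iff[OF x(1)] A.Q_refl[OF x(1)] by blast
  define Y where "Y = {t. (x, t) \<in> A.Q}"
  have Y_uf: "ultrafilter A t" if "t \<in> Y" for t
    using that A.Q_ultrafilter(2) unfolding Y_def by blast
  have Y_up: "s \<in> Y" if "t \<in> Y" "(t, s) \<in> A.Q" for t s
    using that A.Q_trans unfolding Y_def by blast
  have cong: "congruence A (A.point_congruence Y)"
    by (rule A.congruence_point_congruence) (fact Y_uf, fact Y_up)
  obtain B :: "'a bimodal" and h where B: "B \<in> V" and h: "homomorphism A B h" "h ` car A = car B"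
    and ker: "\<And>a b. \<lbrakk>a \<in> car A; b \<in> car A\<rbrakk> \<Longrightarrow> h a = h b \<longleftrightarrow> (a, b) \<in> A.point_congruence Y"
    using variety_quotient[OF V(1) A cong] by blast
  have h_eq: "h a = h b \<longleftrightarrow> (\<forall>t\<in>Y. a \<in> t \<longleftrightarrow> b \<in> t)" if "a \<in> car A" "b \<in> car A" for a b
    using ker[OF that] that by (simp add: A.mem_point_congruence)
  have h_op: "h (bzero A) = bzero B" "\<And>a. a \<in> car A \<Longrightarrow> h (dia A (exi A a)) = dia B (exi B (h a))"
    "\<And>a b. \<lbrakk>a \<in> car A; b \<in> car A\<rbrakk> \<Longrightarrow> h (meet A a b) = meet B (h a) (h b)"
    using h(1) by (simp_all add: homomorphism_def A.exi_closed)
  interpret B: ms4_algebra B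
    using B V(2) by (auto simp: MpS4_def)
  have ax: "satisfies B (MpCas, One)"
    using B V(2) by (auto simp: MpS4_def)
  have hc: "h c \<in> car B"
    using c(1) h(2) by blast
  have "x \<in> Y"
    using A.Q_refl[OF x(1)] by (simp add: Y_def)
  \<comment> \<open>A nonzero element of \<open>B\<close> is the image of some \<open>b\<close> with
    a point \<open>t\<close> in \<open>Y\<close>; every point of \<open>c\<close> sees
    \<open>x\<close> and hence \<open>t\<close>.\<close>
  have opremum: "B.opremum (h c)"
    unfolding B.opremum_def
  proof (intro conjI ballI impI)
    show "h c \<in> car B"
      by (fact hc)
    have "h c \<noteq> h (bzero A)"
      using h_eq[OF c(1) A.bzero_closed] cx A.in_ultrafilter_zero[OF x(1)] \<open>x \<in> Y\<close> by blast
    then show "h c \<noteq> bzero B"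
      using h_op(1) by simp
    fix b' assume b': "b' \<in> car B" "b' \<noteq> bzero B"
    then obtain b where b: "b \<in> car A" "b' = h b"
      using h(2) by blast
    then have "h b \<noteq> h (bzero A)"
      using b'(2) h_op(1) by simp
    then obtain t where t: "t \<in> Y" "b \<in> t"
      using h_eq[OF b(1) A.bzero_closed] A.in_ultrafilter_zero[OF Y_uf] by blast
    have db: "dia A (exi A b) \<in> car A"
      using b(1) A.closed by simp
    have "dia A (exi A b) \<in> s" if s: "ultrafilter A s" "c \<in> s" for s
    proof -
      have "(s, t) \<in> A.Q"
        using c_iff[OF s(1)] s(2) t(1) A.Q_trans unfolding Y_def by blast
      then show ?thesis
        using A.in_ultrafilter_dia_exi[OF s(1) b(1)] t(2) by blast
    qed
    then have "meet A c (dia A (exi A b)) = c"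
      using A.leq_iff[OF c(1) db] unfolding leq_def by blast
    then show "leq B (h c) (dia B (exi B b'))"
      unfolding leq_def b(2) h_op(2)[OF b(1), symmetric] h_op(3)[OF c(1) db, symmetric] by simp
  qed
  have dc: "dia A (exi A c) \<in> car A"
    using c(1) A.closed by simp
  \<comment> \<open>A point of \<open>Y\<close> that sees the cluster also sees \<open>x\<close>, so
    it already belongs to the cluster. The roots of the quotient are thus given by
    \<open>h c\<close> itself.\<close>
  have "dia A (exi A c) \<in> t \<longleftrightarrow> c \<in> t" if t: "t \<in> Y" for t
  proof
    assume "dia A (exi A c) \<in> t"
    then obtain s where s: "(t, s) \<in> A.Q" "c \<in> s"
      using A.in_ultrafilter_dia_exi[OF Y_uf[OF t] c(1)] by blast
    then have "(t, x) \<in> A.Q"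
      using c_iff[OF A.Q_ultrafilter(2)[OF s(1)]] A.Q_trans[OF s(1)] by blast
    then show "c \<in> t"
      using t c_iff[OF Y_uf[OF t]] unfolding Y_def by blast
  qed (use A.leq_dia_exi[OF c(1) Y_uf[OF t]] in blast)
  then have "dia B (exi B (h c)) = h c"
    using h_eq[OF dc c(1)] h_op(2)[OF c(1)] by simp
  then have "bottom_algebra B = relativization B (stone B (h c))"
    using B.bottom_algebra_opremum[OF ax V(3)[OF B] opremum] by simp
  moreover have "satisfies (bottom_algebra B) e"
    using e[OF B B.opremum_subdirectly_irreducible[OF opremum]] .
  ultimately have sat: "satisfies (relativization B (stone B (h c))) e"
    by simp
  let ?I = "interval_algebra A c"
  have hom: "homomorphism ?I (relativization B (stone B (h c))) (stone B \<circ> h)"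
    using homomorphism_comp[OF homomorphism_interval_algebra[OF h(1) A.bimodal_algebra_axioms c(1)]
        B.homomorphism_stone[OF hc]] .
  \<comment> \<open>The quotient forgets only points outside \<open>Y\<close>, and elements below
    \<open>c\<close> have all their points in the cluster, inside \<open>Y\<close>.\<close>
  have "inj_on (stone B \<circ> h) (car ?I)"
  proof (rule inj_onI)
    fix a b assume ab: "a \<in> car ?I" "b \<in> car ?I" "(stone B \<circ> h) a = (stone B \<circ> h) b"
    then have abA: "a \<in> car A" "b \<in> car A" "leq A a c" "leq A b c"
      by (auto simp: interval_algebra_def)
    then have "h a \<in> car B" "h b \<in> car B"
      using h(2) by blast+
    then have "h a = h b"
      using ab(3) inj_onD[OF B.inj_on_stone] by simp
    then have eq: "a \<in> t \<longleftrightarrow> b \<in> t" if "t \<in> Y" for t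
      using h_eq[OF abA(1,2)] that by blast
    show "a = b"
    proof (rule A.ultrafilter_eqI[OF abA(1,2)])
      fix t assume t: "ultrafilter A t"
      have "c \<in> t" if "a \<in> t \<or> b \<in> t"
        using that A.ultrafilter_leq[OF t _ abA(3) c(1)] A.ultrafilter_leq[OF t _ abA(4) c(1)] by blast
      then show "a \<in> t \<longleftrightarrow> b \<in> t"
        using c_iff[OF t] eq[of t] unfolding Y_def by blast
    qed
  qed
  then have "satisfies ?I e"
    using bimodal_algebra.satisfies_embedding[OF A.bimodal_interval_algebra[OF c(1)] hom _ sat] by blast
  then show ?thesis
    using A.satisfies_relativization[OF c(1)] unfolding c(2) by blast
qed

theorem theorem4p18:
  fixes V :: "'a bimodal set"
  assumes "variety V" and "V \<subseteq> MpS4" and "finite_depth V"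
  shows "(bottom_variety V :: 'b bimodal set) =
    gen_variety {relativization A U | A U. A \<in> V \<and>
      clopen_in (points (dual_frame A)) U \<and> Q_cluster (dual_frame A) U}"
proof -
  obtain N where N: "\<And>A. A \<in> V \<Longrightarrow> depth A \<le> enat N"
    using assms(3) unfolding finite_depth_def by blast
  let ?K = "bottom_algebra ` {A \<in> V. subdirectly_irreducible A}"
  let ?L = "{relativization A U | A U. A \<in> V \<and>
      clopen_in (points (dual_frame A)) U \<and> Q_cluster (dual_frame A) U}"
  have "?K \<subseteq> ?L"
  proof
    fix C assume "C \<in> ?K"
    then obtain A where A: "A \<in> V" "subdirectly_irreducible A" "C = bottom_algebra A"
      by blast
    then obtain U where "clopen_in (points (dual_frame A)) U" "Q_cluster (dual_frame A) U"
        "bottom_algebra A = relativization A U"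
      using bottom_algebra_is_cluster_relativization[OF _ N] assms(2) by blast
    then show "C \<in> ?L"
      using A by blast
  qed
  \<comment> \<open>Each generated variety consists of the models of the identities of its
    generators, so equal sets of identities suffice on any carrier type \<open>'b\<close>.\<close>
  then have "identities ?L \<subseteq> identities ?K"
    unfolding identities_def by blast
  moreover have "identities ?K \<subseteq> identities ?L"
  proof
    fix e assume "e \<in> identities ?K"
    then have "satisfies (bottom_algebra B) e" if "B \<in> V" "subdirectly_irreducible B" for B
      using that unfolding identities_def by blast
    then have "satisfies (relativization A U) e"
      if "A \<in> V" "clopen_in (points (dual_frame A)) U" "Q_cluster (dual_frame A) U" for A U
      using cluster_relativization_satisfies[OF assms(1,2) N that] by blast
    then show "e \<in> identities ?L"
      unfolding identities_def by blast
  qed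
  ultimately have "identities ?K = identities ?L"
    by (rule subset_antisym[rotated])
  then show ?thesis
    unfolding bottom_variety_def gen_variety_def by simp
qed

end
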